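(* There exist absolute constants $C_0\ge1$ and $C>0$ such that the following holds. Let $N\ge0$ be an integer, $\mu\ge0$, and let $\Gamma\in L^\infty((0,1);\mathbb C^{2\times2})$ satisfy $\|\Gamma(t)\|_{\mathbb C^{2\times2}}\le\mu$ for almost every $t\in(0,1)$. Let $q\in H^2((0,1);\mathcal H_N)$ solve \[ q_{tt}+q_t-A_0q=C_N^*\Gamma(t)C_Nq\quad\text{in }(0,1). \] If $N+1\ge C_0(1+\mu^2)$, then \[ \mathcal E_N[q](0)\le\exp\bigl(C(N+1)\bigr)\int_0^1|C_Nq(t)|^2\,dt . \] The constant $C$ is independent of the measurable matrix function $\Gamma$.
   Context: Let $\omega(\varphi)=(\sin\varphi)^{1/2}$, $\mathcal H=L^2((0,\pi),\omega\,d\varphi)$, and let $\Phi_n(\varphi)=\mathfrak h_n^{-1/2}C_n^{1/4}(\cos\varphi)$, where $C_n^{1/4}$ is the Gegenbauer polynomial of degree $n$ and parameter $1/4$ and $\mathfrak h_n=\frac{\pi\sqrt2\,\Gamma(n+1/2)}{\Gamma(n+1)(n+1/4)\Gamma(1/4)^2}$; $\{\Phi_n\}_{n\ge0}$ is an orthonormal basis of $\mathcal H$. $A_0$ and $T$ are the self-adjoint operators on $\mathcal H$ with $A_0\Phi_n=2n(2n+1)\Phi_n$ and $T\Phi_n=2n\Phi_n$ (so $A_0f=-4\omega^{-1}(\omega f')'$). For an integer $N\ge0$, $\mathcal H_N=\operatorname{span}\{\Phi_0,\dots,\Phi_N\}\subset\mathcal H$, and $C_N:\mathcal H_N\to\mathbb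 C^2$ is $C_Nf=(f(0),f(\pi))^{\mathsf T}$, with adjoint $C_N^*:\mathbb C^2\to\mathcal H_N$ taken with respect to the $\mathcal H$ scalar product on $\mathcal H_N$ and the Euclidean scalar product on $\mathbb C^2$. The Cauchy-data energy is $\mathcal E_N[q](0)=\|q_t(0)\|_{\mathcal H}^2+\|(T+I)q(0)\|_{\mathcal H}^2$. *)

theory Defs
  imports "HOL-Analysis.Analysis"
begin

definition gegenbauer :: "real \<Rightarrow> nat \<Rightarrow> real \<Rightarrow> real" where
  "gegenbauer a n x =
     (\<Sum>k\<le>n div 2. (-1) ^ k * pochhammer a (n - k) / (fact k * fact (n - 2 * k)) * (2 * x) ^ (n - 2 * k))"

definition h_const :: "nat \<Rightarrow> real" where
  "h_const n = pi * sqrt 2 * Gamma (real n + 1/2)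
                 / (Gamma (real n + 1) * (real n + 1/4) * (Gamma (1/4))\<^sup>2)"

definition Phi :: "nat \<Rightarrow> real \<Rightarrow> complex" where
  "Phi n x = complex_of_real (h_const n powr (-1/2) * gegenbauer (1/4) n (cos x))"

text \<open>Elements of \<open>L\<^sup>2((0,\<pi>), \<omega> d\<phi>)\<close> are represented by functions
  \<open>real \<Rightarrow> complex\<close>, of which only the values on \<open>(0,\<pi>)\<close> matter for inner product and norm.
  The inner product is linear in the first argument.\<close>

definition weight :: "real \<Rightarrow> real" where
  "weight x = sqrt (sin x)"

definition innerH :: "(real \<Rightarrow> complex) \<Rightarrow> (real \<Rightarrow> complex) \<Rightarrow> complex" where
  "innerH f g = (LINT x|lebesgue_on {0<..<pi}. f x * cnj (g x) * complex_of_real (weight x))"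

definition normH :: "(real \<Rightarrow> complex) \<Rightarrow> real" where
  "normH f = sqrt (Re (innerH f f))"

text \<open>Every element of \<open>HN N\<close> is a polynomial in \<open>cos\<close>; it is kept as a function on all of \<open>real\<close>,
  which is determined by its restriction to \<open>(0,\<pi>)\<close>, so the endpoint values are meaningful.\<close>

definition HN :: "nat \<Rightarrow> (real \<Rightarrow> complex) set" where
  "HN N = {f. \<exists>c :: nat \<Rightarrow> complex. f = (\<lambda>x. \<Sum>n\<le>N. c n * Phi n x)}"

text \<open>The operator that is diagonal in the orthonormal basis \<open>Phi\<close> with eigenvalues \<open>m n\<close>.
  It is only applied to elements of the spaces \<open>HN N\<close>, where the series has finitely many
  nonzero terms.\<close>

definition diag_op :: "(nat \<Rightarrow> real) \<Rightarrow> (real \<Rightarrow> complex) \<Rightarrow> real \<Rightarrow> complex" where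
  "diag_op m f x = (\<Sum>n. complex_of_real (m n) * innerH f (Phi n) * Phi n x)"

definition A0 :: "(real \<Rightarrow> complex) \<Rightarrow> real \<Rightarrow> complex" where
  "A0 = diag_op (\<lambda>n. 2 * real n * (2 * real n + 1))"

definition T_op :: "(real \<Rightarrow> complex) \<Rightarrow> real \<Rightarrow> complex" where
  "T_op = diag_op (\<lambda>n. 2 * real n)"

definition inner_C2 :: "complex ^ 2 \<Rightarrow> complex ^ 2 \<Rightarrow> complex" where
  "inner_C2 v w = (\<Sum>i\<in>UNIV. v $ i * cnj (w $ i))"

definition C_obs :: "(real \<Rightarrow> complex) \<Rightarrow> complex ^ 2" where
  "C_obs f = vector [f 0, f pi]"

definition C_adj :: "nat \<Rightarrow> complex ^ 2 \<Rightarrow> real \<Rightarrow> complex" where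
  "C_adj N v = (THE g. g \<in> HN N \<and> (\<forall>f\<in>HN N. inner_C2 (C_obs f) v = innerH f g))"

text \<open>Since \<open>HN N\<close> is finite-dimensional, measurability of, and equality of integrals of,
  \<open>HN N\<close>-valued functions are expressed by testing against all vectors of \<open>HN N\<close>.\<close>

definition L2_curve :: "nat \<Rightarrow> (real \<Rightarrow> real \<Rightarrow> complex) \<Rightarrow> bool" where
  "L2_curve N u \<longleftrightarrow>
     (AE t in lebesgue_on {0<..<1}. u t \<in> HN N) \<and>
     (\<forall>f\<in>HN N. (\<lambda>t. innerH (u t) f) \<in> borel_measurable (lebesgue_on {0<..<1})) \<and>
     integrable (lebesgue_on {0<..<1}) (\<lambda>t. (normH (u t))\<^sup>2)"

definition test_function :: "(real \<Rightarrow> real) \<Rightarrow> bool" where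
  "test_function \<eta> \<longleftrightarrow>
     (\<forall>k x. (deriv ^^ k) \<eta> field_differentiable at x) \<and>
     (\<exists>a b. 0 < a \<and> b < 1 \<and> (\<forall>t. t \<notin> {a..b} \<longrightarrow> \<eta> t = 0))"

definition weak_deriv ::
    "nat \<Rightarrow> (real \<Rightarrow> real \<Rightarrow> complex) \<Rightarrow> (real \<Rightarrow> real \<Rightarrow> complex) \<Rightarrow> bool" where
  "weak_deriv N u v \<longleftrightarrow>
     (\<forall>\<eta>. test_function \<eta> \<longrightarrow> (\<forall>f\<in>HN N.
        (LINT t|lebesgue_on {0<..<1}. deriv \<eta> t *\<^sub>R innerH (u t) f)
        = - (LINT t|lebesgue_on {0<..<1}. \<eta> t *\<^sub>R innerH (v t) f)))"

definition cont_curve :: "nat \<Rightarrow> (real \<Rightarrow> real \<Rightarrow> complex) \<Rightarrow> bool" where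
  "cont_curve N u \<longleftrightarrow>
     (\<forall>t\<in>{0..1}. u t \<in> HN N \<and>
        ((\<lambda>s. normH (\<lambda>x. u s x - u t x)) \<longlongrightarrow> 0) (at t within {0..1}))"

text \<open>\<open>q\<close> belongs to \<open>H\<^sup>2((0,1); HN N)\<close> with first and second weak derivatives \<open>qt\<close> and \<open>qtt\<close>.
  As usual, \<open>q\<close> and \<open>qt\<close> are identified with their representatives continuous on \<open>[0,1]\<close>, which
  give the Cauchy data at time \<open>0\<close>; \<open>qtt\<close> is determined only almost everywhere.\<close>

definition H2_curve ::
    "nat \<Rightarrow> (real \<Rightarrow> real \<Rightarrow> complex) \<Rightarrow> (real \<Rightarrow> real \<Rightarrow> complex) \<Rightarrow> (real \<Rightarrow> real \<Rightarrow> complex) \<Rightarrow> bool" where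
  "H2_curve N q qt qtt \<longleftrightarrow>
     L2_curve N q \<and> L2_curve N qt \<and> L2_curve N qtt \<and>
     weak_deriv N q qt \<and> weak_deriv N qt qtt \<and>
     cont_curve N q \<and> cont_curve N qt"

definition energy0 :: "(real \<Rightarrow> real \<Rightarrow> complex) \<Rightarrow> (real \<Rightarrow> real \<Rightarrow> complex) \<Rightarrow> real" where
  "energy0 q qt = (normH (qt 0))\<^sup>2 + (normH (\<lambda>x. T_op (q 0) x + q 0 x))\<^sup>2"

end

theory Submission
  imports Defs "HOL-Computational_Algebra.Polynomial" "HOL-Real_Asymp.Real_Asymp"
begin

text \<open>
  Let \<open>a n\<close> be the coefficient of \<open>q\<close> along \<open>Phi n\<close>. The equation splits into the scalar
  equations \<open>a n'' + a n' - 2n(2n+1) a n = g n\<close>, which are coupled only through the right-hand sides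
  \<open>g n = Phi n 0 * ((\<Gamma> C q)_1 + (-1)^n (\<Gamma> C q)_2)\<close>. The roots of mode \<open>n\<close> are
  \<open>2n\<close> and \<open>-(2n+1)\<close>. With \<open>freq m = (-1)^m m\<close> they are \<open>freq (2n)\<close> and \<open>freq (2n+1)\<close>, so the
  roots of all modes up to \<open>N\<close> are the distinct integers \<open>freq 0, \<dots>, freq (2N+1)\<close>. The amplitudes
  \<open>amp m = a n' + (1 + freq m) a n\<close>, where \<open>n = m div 2\<close>, solve \<open>amp m' = freq m * amp m + g n\<close>,
  and \<open>a n\<close> and \<open>a n'\<close> are combinations of \<open>amp (2n)\<close> and \<open>amp (2n+1)\<close>.

  The point is that the forcing is controlled by the observation, \<open>|g n| \<le> 2 \<mu> |Phi n 0| |C q|\<close>,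
  and that a factor \<open>exp (O(N))\<close> is affordable. Solving forward from \<open>t = 0\<close> by Duhamel's formula
  (\<open>duhamel_estimate\<close>) therefore replaces \<open>amp m t\<close> by \<open>exp (freq m * t) * amp m 0\<close>, up to an error
  of size \<open>exp (O(N)) * (integral of |C q|)\<close>; the hypothesis relating \<open>N\<close> and \<open>\<mu>\<close> gives
  \<open>\<mu> \<le> N + 1\<close>, so \<open>\<mu>\<close> is absorbed too. Because \<open>Phi n pi = (-1)^n Phi n 0\<close>, half the sum and
  half the difference of the two endpoint values of \<open>q\<close> contain only the even and only the odd modes.
  Each of them is thus close to an exponential sum \<open>\<Sum> c m * exp (freq m * t)\<close>, where
  \<open>c m = Phi n 0 * amp m 0 / (2 freq m + 1)\<close> for \<open>n\<close> of that parity and \<open>c m = 0\<close> otherwise.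

  The coefficients of such a sum are recovered from its integral over the unit interval by difference
  operators: \<open>u \<mapsto> u(t + h) - exp (k h) u(t)\<close> removes the frequency \<open>k\<close> and multiplies the other
  coefficients by \<open>exp (freq m * h) - exp (k * h)\<close>. Applying it for all frequencies but one, with \<open>h\<close>
  of order \<open>1 / N\<close>, costs only \<open>exp (O(N))\<close>, since the product of the distances between integers
  is of factorial size (\<open>freq_coefficient_bound\<close>). Together with \<open>|Phi n 0| \<ge> 1/2\<close> this bounds all
  \<open>amp m 0\<close>, hence the energy (\<open>energy_bound\<close>).

  Two foundations support this. The \<open>Phi n\<close> are orthonormal (\<open>innerH_Phi\<close>): the
  Gegenbauer equation is of Sturm-Liouville form, which gives orthogonality, and the three-term recurrence
  reduces the normalisation to a Beta integral. And a weak derivative against smooth test functions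
  supported inside the interval is a derivative in integral form up to the endpoint \<open>0\<close>
  (\<open>weak_derivative_imp_integral\<close>), which is shown by testing with explicit smooth steps.
\<close>

section \<open>Gegenbauer polynomials: recurrence and differential equation\<close>

text \<open>The terms are extended by \<open>0\<close> beyond \<open>n div 2\<close>, so that sums for different degrees can be
  taken over a common range and compared term by term.\<close>

definition gegenbauer_term :: "real \<Rightarrow> nat \<Rightarrow> nat \<Rightarrow> real \<Rightarrow> real" where
  "gegenbauer_term a n k x =
     (if 2 * k \<le> n then (-1) ^ k * pochhammer a (n - k) / (fact k * fact (n - 2 * k)) * (2 * x) ^ (n - 2 * k) else 0)"

lemma gegenbauer_eq_sum_terms:
  assumes "n div 2 \<le> m"
  shows "gegenbauer a n x = (\<Sum>k\<le>m. gegenbauer_term a n k x)"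
proof -
  have "(\<Sum>k\<le>m. gegenbauer_term a n k x) = (\<Sum>k\<le>n div 2. gegenbauer_term a n k x)"
    by (rule sum.mono_neutral_right) (use assms in \<open>auto simp: gegenbauer_term_def\<close>)
  also have "\<dots> = gegenbauer a n x"
    unfolding gegenbauer_def by (rule sum.cong) (auto simp: gegenbauer_term_def)
  finally show ?thesis by simp
qed

lemma gegenbauer_term_0_step:
  "(real n + 2) * gegenbauer_term a (n + 2) 0 x = 2 * (real n + 1 + a) * x * gegenbauer_term a (n + 1) 0 x"
  by (simp add: gegenbauer_term_def pochhammer_Suc divide_simps) (simp add: algebra_simps)

lemma gegenbauer_term_Suc_step:
  "(real n + 2) * gegenbauer_term a (n + 2) (Suc k) x =
     2 * (real n + 1 + a) * x * gegenbauer_term a (n + 1) (Suc k) x - (real n + 2 * a) * gegenbauer_term a n k x"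
proof -
  consider j where "n = 2 * k + 1 + j" | "n = 2 * k" | "n < 2 * k"
    by (metis Suc_eq_plus1 less_iff_Suc_add linorder_neqE_nat add_Suc add_Suc_right Suc_leI le_add_diff_inverse)
  then show ?thesis
  proof cases
    case (1 j)
    have e: "n + 2 - Suc k = Suc (Suc (k + j))" "n + 1 - Suc k = Suc (k + j)" "n - k = Suc (k + j)"
      "n + 2 - 2 * Suc k = Suc j" "n + 1 - 2 * Suc k = j" "n - 2 * k = Suc j"
      "2 * Suc k \<le> n + 2" "2 * Suc k \<le> n + 1" "2 * k \<le> n"
      using 1 by auto
    define P where "P = pochhammer a (Suc (k + j))"
    have P: "pochhammer a (Suc (Suc (k + j))) = P * (a + real k + real j + 1)"
      unfolding P_def by (subst pochhammer_Suc) (simp add: algebra_simps)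
    have n: "real n = 2 * real k + 1 + real j" using 1 by simp
    show ?thesis
      unfolding gegenbauer_term_def if_P[OF e(7)] if_P[OF e(8)] if_P[OF e(9)] e P P_def[symmetric] n
      by (simp add: divide_simps) (simp add: algebra_simps)
  next
    case 2
    show ?thesis unfolding gegenbauer_term_def 2
      by (simp add: pochhammer_Suc divide_simps Suc_diff_le) (simp add: algebra_simps)
  next
    case 3
    then show ?thesis by (simp add: gegenbauer_term_def)
  qed
qed

text \<open>The recurrence holds separately for each power of \<open>2x\<close>: the term \<open>k + 1\<close> of degree \<open>n + 2\<close> only
  meets the term \<open>k + 1\<close> of degree \<open>n + 1\<close> and the term \<open>k\<close> of degree \<open>n\<close>.\<close>

lemma gegenbauer_recurrence:
  "(real n + 2) * gegenbauer a (n + 2) x =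
     2 * (real n + 1 + a) * x * gegenbauer a (n + 1) x - (real n + 2 * a) * gegenbauer a n x"
proof -
  have 1: "gegenbauer a (n + 2) x = gegenbauer_term a (n + 2) 0 x + (\<Sum>k\<le>n. gegenbauer_term a (n + 2) (Suc k) x)"
    by (subst gegenbauer_eq_sum_terms[of _ "Suc n"]) (auto simp only: sum.atMost_Suc_shift)
  have 2: "gegenbauer a (n + 1) x = gegenbauer_term a (n + 1) 0 x + (\<Sum>k\<le>n. gegenbauer_term a (n + 1) (Suc k) x)"
    by (subst gegenbauer_eq_sum_terms[of _ "Suc n"]) (auto simp only: sum.atMost_Suc_shift)
  have 3: "gegenbauer a n x = (\<Sum>k\<le>n. gegenbauer_term a n k x)"
    by (rule gegenbauer_eq_sum_terms) auto
  show ?thesis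
    unfolding 1 2 3
    by (simp only: distrib_left gegenbauer_term_0_step sum_distrib_left gegenbauer_term_Suc_step sum_subtractf)
qed

lemma gegenbauer_0 [simp]: "gegenbauer a 0 x = 1"
  by (simp add: gegenbauer_def)

lemma gegenbauer_1 [simp]: "gegenbauer a (Suc 0) x = 2 * a * x"
  by (simp add: gegenbauer_def)

fun gegenbauer_poly :: "real \<Rightarrow> nat \<Rightarrow> real poly" where
  "gegenbauer_poly a 0 = 1"
| "gegenbauer_poly a (Suc 0) = [:0, 2 * a:]"
| "gegenbauer_poly a (Suc (Suc n)) =
     smult (1 / (real n + 2)) ([:0, 2 * (real n + 1 + a):] * gegenbauer_poly a (Suc n) - smult (real n + 2 * a) (gegenbauer_poly a n))"

text \<open>Formal polynomials defined by the recurrence make derivatives available through \<^const>\<open>pderiv\<close>.\<close>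

lemma poly_gegenbauer_poly: "poly (gegenbauer_poly a n) x = gegenbauer a n x"
proof (induction a n rule: gegenbauer_poly.induct)
  case (3 a n)
  show ?case
    using gegenbauer_recurrence[of n a x]
    by (simp add: 3 field_simps)
qed auto

definition gegenbauer_deriv :: "real \<Rightarrow> nat \<Rightarrow> real \<Rightarrow> real" where
  "gegenbauer_deriv a n x = poly (pderiv (gegenbauer_poly a n)) x"

lemma gegenbauer_deriv_recurrence:
  "(real n + 2) * gegenbauer_deriv a (n + 2) x =
     2 * (real n + 1 + a) * (gegenbauer a (n + 1) x + x * gegenbauer_deriv a (n + 1) x) - (real n + 2 * a) * gegenbauer_deriv a n x"
  by (simp add: gegenbauer_deriv_def pderiv_smult pderiv_diff pderiv_mult pderiv_pCons poly_gegenbauer_poly[symmetric])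
     (simp add: algebra_simps)

text \<open>Neither relation is inductive alone: differentiating the recurrence expresses the first at
  \<open>n + 1\<close> through both relations at \<open>n\<close>.\<close>

lemma gegenbauer_deriv_relations:
  "(1 - x\<^sup>2) * gegenbauer_deriv a (n + 1) x = (real n + 2 * a) * gegenbauer a n x - (real n + 1) * x * gegenbauer a (n + 1) x"
  "(1 - x\<^sup>2) * gegenbauer_deriv a n x = (real n + 2 * a) * x * gegenbauer a n x - (real n + 1) * gegenbauer a (n + 1) x"
proof (induction n)
  case 0
  {
    case 1 show ?case by (simp add: gegenbauer_deriv_def pderiv_pCons power2_eq_square algebra_simps)
  next
    case 2 show ?case by (simp add: gegenbauer_deriv_def)
  }
next
  case (Suc n)
  define X where "X = 1 - x\<^sup>2"
  have r: "(real n + 2) * gegenbauer a (n + 2) x =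
     2 * (real n + 1 + a) * x * gegenbauer a (n + 1) x - (real n + 2 * a) * gegenbauer a n x"
    by (rule gegenbauer_recurrence)
  {
    case 1
    have "(real n + 2) * (X * gegenbauer_deriv a (n + 2) x) = X * ((real n + 2) * gegenbauer_deriv a (n + 2) x)" by simp
    also have "\<dots> = 2 * (real n + 1 + a) * (X * gegenbauer a (n + 1) x + x * (X * gegenbauer_deriv a (n + 1) x))
       - (real n + 2 * a) * (X * gegenbauer_deriv a n x)"
      unfolding gegenbauer_deriv_recurrence by (simp add: algebra_simps)
    also have "\<dots> = (real n + 2) * ((real n + 1 + 2 * a) * gegenbauer a (n + 1) x)
        - (real n + 2) * x * ((real n + 2) * gegenbauer a (n + 2) x)"
      unfolding X_def Suc r by (simp add: power2_eq_square) algebra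
    also have "\<dots> = (real n + 2) * ((real n + 1 + 2 * a) * gegenbauer a (n + 1) x
        - (real n + 2) * x * gegenbauer a (n + 2) x)"
      by (simp add: algebra_simps)
    finally have "X * gegenbauer_deriv a (n + 2) x = (real n + 1 + 2 * a) * gegenbauer a (n + 1) x
        - (real n + 2) * x * gegenbauer a (n + 2) x"
      by (smt (verit) mult_left_cancel of_nat_0_le_iff)
    then show ?case unfolding X_def by (simp add: algebra_simps)
  next
    case 2
    show ?case using Suc(1) r by (simp add: algebra_simps)
  }
qed

text \<open>The equation follows by differentiating the first of the two relations and eliminating the
  derivative of the lower polynomial. That elimination divides by \<open>1 - x\<^sup>2\<close>; the open interval is
  where the equation is used.\<close>

lemma gegenbauer_ode:
  assumes "x\<^sup>2 \<noteq> 1"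
  shows "(1 - x\<^sup>2) * poly (pderiv (pderiv (gegenbauer_poly a n))) x - (2 * a + 1) * x * gegenbauer_deriv a n x
           + real n * (real n + 2 * a) * gegenbauer a n x = 0"
proof (cases n)
  case 0
  then show ?thesis by (simp add: gegenbauer_deriv_def)
next
  case (Suc m)
  define y z where "y = gegenbauer_deriv a (m + 1) x" and "z = gegenbauer_deriv a m x"
  have "(1 - x\<^sup>2) * (x * y - (real m + 1) * gegenbauer a (m + 1) x)
      = x * ((1 - x\<^sup>2) * y) - (1 - x\<^sup>2) * (real m + 1) * gegenbauer a (m + 1) x"
    by (simp add: algebra_simps)
  also have "\<dots> = (1 - x\<^sup>2) * z"
    unfolding y_def z_def gegenbauer_deriv_relations(1)[of x a m] gegenbauer_deriv_relations(2)[of x a m]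
    by (simp add: power2_eq_square algebra_simps)
  finally have "(1 - x\<^sup>2) * z = (1 - x\<^sup>2) * (x * y - (real m + 1) * gegenbauer a (m + 1) x)" ..
  then have z: "z = x * y - (real m + 1) * gegenbauer a (m + 1) x"
    using assms by simp
  let ?P = "[:1, 0, -1:] * pderiv (gegenbauer_poly a (m + 1))"
  let ?Q = "smult (real m + 2 * a) (gegenbauer_poly a m) - [:0, real m + 1:] * gegenbauer_poly a (m + 1)"
  have "poly ?P t = poly ?Q t" for t
    using gegenbauer_deriv_relations(1)[of t a m]
    by (simp add: gegenbauer_deriv_def poly_gegenbauer_poly power2_eq_square algebra_simps)
  then have "?P = ?Q" by (rule poly_eq_poly_eq_iff[THEN iffD1, OF ext])
  then have "poly (pderiv ?P) x = poly (pderiv ?Q) x" by simp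
  then have "(1 - x\<^sup>2) * poly (pderiv (pderiv (gegenbauer_poly a (m + 1)))) x - 2 * x * y
    = (real m + 2 * a) * z - (real m + 1) * (gegenbauer a (m + 1) x + x * y)"
    unfolding pderiv_mult pderiv_diff
    by (simp add: pderiv_smult pderiv_pCons y_def z_def gegenbauer_deriv_def poly_gegenbauer_poly power2_eq_square algebra_simps)
  with z have "(1 - x\<^sup>2) * poly (pderiv (pderiv (gegenbauer_poly a (m + 1)))) x - (2 * a + 1) * x * y
           + (real m + 1) * (real m + 1 + 2 * a) * gegenbauer a (m + 1) x = 0"
    by algebra
  then show ?thesis unfolding Suc y_def by (simp add: add_ac)
qed

section \<open>Orthogonality and normalisation\<close>

abbreviation geg :: "nat \<Rightarrow> real \<Rightarrow> real" where
  "geg n x \<equiv> gegenbauer (1/4) n (cos x)"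

lemma continuous_on_gegenbauer_cos [continuous_intros]:
  "continuous_on S (\<lambda>x. gegenbauer a n (cos x))"
  unfolding poly_gegenbauer_poly[symmetric] by (intro continuous_intros)

lemma continuous_on_weight [continuous_intros]: "continuous_on S weight"
  unfolding weight_def by (intro continuous_intros)

text \<open>This is \<open>\<omega> f'\<close> for \<open>f = geg n\<close>, the quantity of the Sturm-Liouville form
  \<open>(\<omega> f')' = - n (n + 1/2) \<omega> f\<close>. It is written with the explicit factor \<open>sin\<close>, which makes it continuous
  on the closed interval with value \<open>0\<close> at both ends.\<close>

definition flux :: "nat \<Rightarrow> real \<Rightarrow> real" where
  "flux n x = - (weight x * sin x * gegenbauer_deriv (1/4) n (cos x))"

lemma geg_has_derivative:
  "((\<lambda>x. geg n x) has_real_derivative - (sin x * gegenbauer_deriv (1/4) n (cos x))) (at x)"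
  unfolding poly_gegenbauer_poly[symmetric] gegenbauer_deriv_def
  by (auto intro!: derivative_eq_intros)

lemma flux_has_derivative:
  assumes x: "0 < x" "x < pi"
  shows "(flux n has_real_derivative - (real n * (real n + 1/2)) * weight x * geg n x) (at x)"
proof -
  have s: "sin x > 0" using x by (rule sin_gt_zero)
  have ode: "(1 - (cos x)\<^sup>2) * poly (pderiv (pderiv (gegenbauer_poly (1/4) n))) (cos x) - (3/2) * cos x * gegenbauer_deriv (1/4) n (cos x)
           + real n * (real n + 1/2) * geg n x = 0"
    using gegenbauer_ode[of "cos x" "1/4" n] s
    by (simp add: abs_square_eq_1 cos_squared_eq)
  have w: "(weight has_real_derivative cos x / (2 * weight x)) (at x)"
    unfolding weight_def using s by (auto intro!: derivative_eq_intros simp: divide_simps)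
  have w2: "weight x * weight x = sin x" "weight x > 0" using s by (auto simp: weight_def)
  have d: "((\<lambda>x. gegenbauer_deriv (1/4) n (cos x)) has_real_derivative
     - (sin x * poly (pderiv (pderiv (gegenbauer_poly (1/4) n))) (cos x))) (at x)"
    unfolding gegenbauer_deriv_def by (auto intro!: derivative_eq_intros)
  have e: "cos x / (2 * weight x) * sin x = weight x * cos x / 2"
    unfolding w2(1)[symmetric] using w2(2) by simp
  have "- (real n * (real n + 1/2)) * weight x * geg n x =
     weight x * ((1 - (cos x)\<^sup>2) * poly (pderiv (pderiv (gegenbauer_poly (1/4) n))) (cos x) - (3/2) * cos x * gegenbauer_deriv (1/4) n (cos x))"
    using ode by algebra
  also have "\<dots> = - ((cos x / (2 * weight x) * sin x + weight x * cos x) * gegenbauer_deriv (1/4) n (cos x)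
     - weight x * sin x * (sin x * poly (pderiv (pderiv (gegenbauer_poly (1/4) n))) (cos x)))"
    unfolding e sin_squared_eq[symmetric] by (simp add: field_simps power2_eq_square)
  finally show ?thesis
    unfolding flux_def[abs_def]
    by (auto intro!: derivative_eq_intros w d simp: algebra_simps)
qed

lemma continuous_on_flux: "continuous_on S (flux n)"
  unfolding flux_def[abs_def] gegenbauer_deriv_def by (intro continuous_intros)

lemma flux_0 [simp]: "flux n 0 = 0" "flux n pi = 0"
  by (simp_all add: flux_def)

text \<open>The integrand is the derivative of the Wronskian \<open>\<omega> (f' g - f g')\<close>, in which the products of two first
  derivatives cancel; the Wronskian vanishes at both endpoints because \<^const>\<open>flux\<close> does.\<close>

lemma wronskian_integral:
  "((\<lambda>x. (real m * (real m + 1/2) - real n * (real n + 1/2)) * (weight x * geg n x * geg m x)) has_integral 0) {0..pi}"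
proof -
  let ?W = "\<lambda>x. flux n x * geg m x - flux m x * geg n x"
  have "((\<lambda>x. (real m * (real m + 1/2) - real n * (real n + 1/2)) * (weight x * geg n x * geg m x)) has_integral ?W pi - ?W 0) {0..pi}"
  proof (rule fundamental_theorem_of_calculus_interior)
    show "continuous_on {0..pi} ?W"
      by (intro continuous_intros continuous_on_flux)
    fix x :: real assume x: "x \<in> {0<..<pi}"
    then have f: "(flux k has_real_derivative - (real k * (real k + 1/2)) * weight x * geg k x) (at x)" for k
      using flux_has_derivative by auto
    show "(?W has_vector_derivative (real m * (real m + 1/2) - real n * (real n + 1/2)) * (weight x * geg n x * geg m x)) (at x)"
      unfolding has_real_derivative_iff_has_vector_derivative[symmetric]
      by (rule derivative_eq_intros f geg_has_derivative refl)+
         (simp add: flux_def algebra_simps)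
  qed simp
  then show ?thesis by simp
qed

definition gram :: "nat \<Rightarrow> nat \<Rightarrow> real" where
  "gram n m = integral {0..pi} (\<lambda>x. weight x * geg n x * geg m x)"

lemma gram_integrable: "(\<lambda>x. weight x * geg n x * geg m x) integrable_on {0..pi}"
  by (intro integrable_continuous_interval continuous_intros)

lemma gram_orthogonal:
  assumes "n \<noteq> m" shows "gram n m = 0"
proof -
  have "(real m * (real m + 1/2) - real n * (real n + 1/2)) * gram n m = 0"
    using integral_unique[OF wronskian_integral[of m n]] by (simp add: gram_def)
  moreover have "real m * (real m + 1/2) - real n * (real n + 1/2) = (real m - real n) * (real m + real n + 1/2)"
    by algebra
  ultimately show ?thesis using assms by auto
qed

text \<open>Integrating the recurrence against \<open>geg n\<close>, and the preceding one against \<open>geg (n + 1)\<close>, leaves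
  by orthogonality the same mixed integral. Eliminating it relates consecutive squared norms.\<close>

lemma gram_mult_cos:
  "(real n + 1/2) * gram n n = 2 * (real n + 5/4) * integral {0..pi} (\<lambda>x. weight x * cos x * geg n x * geg (n + 1) x)"
  "(real n + 1) * gram (n + 1) (n + 1) = 2 * (real n + 1/4) * integral {0..pi} (\<lambda>x. weight x * cos x * geg n x * geg (n + 1) x)"
proof -
  let ?c = "\<lambda>x. weight x * cos x * geg n x * geg (n + 1) x"
  have c: "?c integrable_on {0..pi}"
    by (intro integrable_continuous_interval continuous_intros)
  have "integral {0..pi} (\<lambda>x. (real n + 2) * (weight x * geg (n + 2) x * geg n x)) =
    integral {0..pi} (\<lambda>x. 2 * (real n + 5/4) * ?c x - (real n + 1/2) * (weight x * geg n x * geg n x))"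
  proof (rule integral_cong)
    fix x
    show "(real n + 2) * (weight x * geg (n + 2) x * geg n x) = 2 * (real n + 5/4) * ?c x - (real n + 1/2) * (weight x * geg n x * geg n x)"
      using gegenbauer_recurrence[of n "1/4" "cos x"] by algebra
  qed
  also have "\<dots> = 2 * (real n + 5/4) * integral {0..pi} ?c - (real n + 1/2) * gram n n"
    unfolding gram_def using c
    by (subst integral_diff) (auto intro!: integrable_on_mult_right gram_integrable)
  finally show "(real n + 1/2) * gram n n = 2 * (real n + 5/4) * integral {0..pi} ?c"
    using gram_orthogonal[of "n + 2" n] by (simp add: gram_def)
  show "(real n + 1) * gram (n + 1) (n + 1) = 2 * (real n + 1/4) * integral {0..pi} ?c"
  proof (cases n)
    case 0
    have "gram 1 1 = integral {0..pi} (\<lambda>x. 1/2 * (weight x * cos x * geg 0 x * geg 1 x))"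
      unfolding gram_def by (rule integral_cong) simp
    then show ?thesis unfolding 0 by (subst (asm) integral_mult_right) simp
  next
    case (Suc k)
    have "integral {0..pi} (\<lambda>x. (real n + 1) * (weight x * geg (n + 1) x * geg (n + 1) x)) =
      integral {0..pi} (\<lambda>x. 2 * (real n + 1/4) * ?c x - (real n - 1/2) * (weight x * geg k x * geg (n + 1) x))"
    proof (rule integral_cong)
      fix x
      show "(real n + 1) * (weight x * geg (n + 1) x * geg (n + 1) x) =
        2 * (real n + 1/4) * ?c x - (real n - 1/2) * (weight x * geg k x * geg (n + 1) x)"
        using gegenbauer_recurrence[of k "1/4" "cos x"] unfolding Suc by simp algebra
    qed
    also have "\<dots> = 2 * (real n + 1/4) * integral {0..pi} ?c - (real n - 1/2) * gram k (n + 1)"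
      unfolding gram_def using c
      by (subst integral_diff) (auto intro!: integrable_on_mult_right gram_integrable)
    finally show ?thesis
      using gram_orthogonal[of k "n + 1"] Suc by (simp add: gram_def)
  qed
qed

lemma Gamma_plus1_pos: "x > 0 \<Longrightarrow> Gamma (x + 1) = x * Gamma (x :: real)"
  by (rule Gamma_plus1) (auto elim!: nonpos_Ints_cases)

text \<open>The substitution \<open>t = (1 - cos x) / 2\<close> turns the integral of the weight into
  \<open>sqrt 2 * Beta (3/4) (3/4)\<close>; the reflection formula \<open>Gamma (1/4) * Gamma (3/4) = pi * sqrt 2\<close> brings it into the
  form of \<^const>\<open>h_const\<close>.\<close>

lemma gram_0: "gram 0 0 = pi * sqrt 2 * Gamma (1/2) / (1/4 * (Gamma (1/4))\<^sup>2)"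
proof -
  define f :: "real \<Rightarrow> real" where "f t = t powr (3/4 - 1) * (1 - t) powr (3/4 - 1)" for t
  have hf: "(f has_integral Beta (3/4) (3/4)) {0<..<1}"
    using has_integral_Beta_real[of "3/4" "3/4"] by (simp add: f_def[abs_def] has_integral_Icc_iff_Ioo)
  have img: "(\<lambda>x. (1 - cos x) / 2) ` {0<..<pi} = {0<..<1}"
  proof (intro equalityI subsetI)
    fix t assume "t \<in> (\<lambda>x. (1 - cos x) / 2) ` {0<..<pi}"
    then obtain x where x: "0 < x" "x < pi" "t = (1 - cos x) / 2" by auto
    have "cos x < cos 0" "cos pi < cos x"
      using x cos_monotone_0_pi[of 0 x] cos_monotone_0_pi[of x pi] by simp_all
    then show "t \<in> {0<..<1}" using x by simp
  next
    fix t :: real assume t: "t \<in> {0<..<1}"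
    have "0 < arccos (1 - 2 * t)" "arccos (1 - 2 * t) < pi"
      using t by (simp_all add: arccos_lt_bounded)
    then show "t \<in> (\<lambda>x. (1 - cos x) / 2) ` {0<..<pi}"
      using t by (intro image_eqI[of _ _ "arccos (1 - 2 * t)"]) auto
  qed
  have absf: "f absolutely_integrable_on {0<..<1}"
    using hf by (intro nonnegative_absolutely_integrable_1) (auto simp: f_def)
  have "f absolutely_integrable_on (\<lambda>x. (1 - cos x) / 2) ` {0<..<pi} \<and>
      integral ((\<lambda>x. (1 - cos x) / 2) ` {0<..<pi}) f = Beta (3/4) (3/4)"
    unfolding img using hf absf by (auto simp: integral_unique)
  moreover have "((\<lambda>x. (1 - cos x) / 2) has_real_derivative sin x / 2) (at x within {0<..<pi})" for x :: real
    by (auto intro!: derivative_eq_intros)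
  moreover have "inj_on (\<lambda>x :: real. (1 - cos x) / 2) {0<..<pi}"
    by (rule inj_onI, rule cos_inj_pi) auto
  moreover have "{0<..<pi} \<in> sets lebesgue" by simp
  ultimately have "integral {0<..<pi} (\<lambda>x. \<bar>sin x / 2\<bar> *\<^sub>R f ((1 - cos x) / 2)) = Beta (3/4) (3/4)"
    using has_absolute_integral_change_of_variables_real
      [of "{0<..<pi}" "\<lambda>x. (1 - cos x) / 2" "\<lambda>x. sin x / 2" f "Beta (3/4) (3/4)"] by blast
  also have "integral {0<..<pi} (\<lambda>x. \<bar>sin x / 2\<bar> *\<^sub>R f ((1 - cos x) / 2)) =
      integral {0<..<pi} (\<lambda>x. weight x * geg 0 x * geg 0 x / sqrt 2)"
  proof (rule integral_cong)
    fix x assume x: "x \<in> {0<..<pi}"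
    then have s: "sin x > 0" by (simp add: sin_gt_zero)
    have c: "cos x < cos 0" "cos pi < cos x"
      using x cos_monotone_0_pi[of 0 x] cos_monotone_0_pi[of x pi] by simp_all
    have "f ((1 - cos x) / 2) = ((1 - cos x) / 2 * ((1 + cos x) / 2)) powr (- (1/4))"
      unfolding f_def using c by (subst powr_mult) (auto simp: field_simps)
    also have "(1 - cos x) / 2 * ((1 + cos x) / 2) = (sin x / 2) powr 2"
      using s sin_squared_eq[of x] by (simp add: power2_eq_square algebra_simps add_divide_distrib diff_divide_distrib)
    also have "\<dots> powr (- (1/4)) = (sin x / 2) powr (-1/2)"
      by (simp add: powr_powr)
    also have "\<dots> = inverse (sqrt (sin x / 2))"
      using s by (simp add: powr_minus powr_half_sqrt)
    finally have "\<bar>sin x / 2\<bar> *\<^sub>R f ((1 - cos x) / 2) = (sin x / 2) / sqrt (sin x / 2)"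
      using s by (simp add: field_simps)
    also have "\<dots> = sqrt (sin x / 2)" using s by (intro real_div_sqrt) simp
    finally show "\<bar>sin x / 2\<bar> *\<^sub>R f ((1 - cos x) / 2) = weight x * geg 0 x * geg 0 x / sqrt 2"
      by (simp add: weight_def real_sqrt_divide)
  qed
  also have "\<dots> = gram 0 0 / sqrt 2"
    unfolding gram_def integral_open_interval_real by simp
  finally have g: "gram 0 0 = sqrt 2 * Beta (3/4) (3/4)" by (simp add: field_simps)
  have refl: "Gamma (1/4) * Gamma (3/4 :: real) = pi * sqrt 2"
  proof -
    have "sin (complex_of_real (pi / 4)) = complex_of_real (sqrt 2 / 2)"
      unfolding sin_of_real by (simp add: sin_45)
    then have s: "sin (complex_of_real pi / 4) = complex_of_real (sqrt 2 / 2)"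
      by (simp only: of_real_divide of_real_numeral)
    have "complex_of_real (Gamma (1/4) * Gamma (3/4)) = complex_of_real pi / sin (complex_of_real pi / 4)"
      using Gamma_reflection_complex[of "complex_of_real (1/4)"]
      by (simp add: Gamma_complex_of_real[symmetric])
    also have "\<dots> = complex_of_real (pi / (sqrt 2 / 2))"
      unfolding s by (simp only: of_real_divide)
    finally have "complex_of_real (Gamma (1/4) * Gamma (3/4)) = complex_of_real (pi / (sqrt 2 / 2))" .
    then have "Gamma (1/4) * Gamma (3/4 :: real) = pi / (sqrt 2 / 2)"
      by (simp only: of_real_eq_iff)
    also have "\<dots> = pi * (2 / sqrt 2)" by simp
    also have "2 / sqrt 2 = sqrt 2" by (rule real_div_sqrt) simp
    finally show ?thesis .
  qed
  have G32: "Gamma (3/2 :: real) = Gamma (1/2) / 2"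
    using Gamma_plus1_pos[of "1/2"] by simp
  have pos: "Gamma (1/4 :: real) > 0" "Gamma (1/2 :: real) > 0"
    by (auto intro!: Gamma_real_pos)
  have "gram 0 0 * (Gamma (1/4))\<^sup>2 = sqrt 2 * (Gamma (1/4) * Gamma (3/4))\<^sup>2 / (Gamma (1/2) / 2)"
    unfolding g Beta_def by (simp add: G32 power2_eq_square)
  also have "\<dots> = 4 * sqrt 2 * (pi * pi) / Gamma (1/2)"
    unfolding refl by (simp add: power2_eq_square)
  also have "\<dots> = 4 * sqrt 2 * pi * Gamma (1/2)"
  proof -
    have "pi = Gamma (1/2) * Gamma (1/2)" by (simp add: Gamma_one_half_real)
    then have "4 * sqrt 2 * (pi * pi) / Gamma (1/2) = 4 * sqrt 2 * pi * (Gamma (1/2) * Gamma (1/2)) / Gamma (1/2)"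
      by simp
    then show ?thesis using pos by simp
  qed
  finally show ?thesis using pos(1)[THEN less_imp_neq] by (simp add: eq_divide_eq)
qed

lemma gram_diag: "gram n n = h_const n"
proof (induction n)
  case 0
  show ?case by (simp add: gram_0 h_const_def)
next
  case (Suc n)
  have p: "real n + 5/4 > 0" "real n + 1/4 > 0" "real n + 1 > 0" by auto
  define A B where "A = Gamma (real n + 1/2)" and "B = Gamma (real n + 1)"
  have A: "Gamma (real (Suc n) + 1/2) = (real n + 1/2) * A"
    using Gamma_plus1_pos[of "real n + 1/2"] by (simp add: A_def add_ac)
  have B: "Gamma (real (Suc n) + 1) = (real n + 1) * B"
    using Gamma_plus1_pos[of "real n + 1"] by (simp add: B_def add_ac)
  have B0: "B > 0" unfolding B_def by (rule Gamma_real_pos) simp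
  have "(real n + 1) * gram (n + 1) (n + 1) * (real n + 5/4) = (real n + 1/4) * ((real n + 1/2) * gram n n)"
    unfolding gram_mult_cos(1) gram_mult_cos(2) by algebra
  also have "\<dots> = (real n + 1) * h_const (Suc n) * (real n + 5/4)"
    unfolding Suc h_const_def A B A_def[symmetric] B_def[symmetric] using p B0
    by (simp add: divide_simps) (simp add: algebra_simps)?
  finally show ?case using p by simp
qed

section \<open>Values at the endpoints\<close>

lemma gegenbauer_minus: "gegenbauer a n (- x) = (-1) ^ n * gegenbauer a n x"
proof (induction a n rule: gegenbauer_poly.induct)
  case (3 a n)
  have "(real n + 2) * gegenbauer a (n + 2) (- x) = (-1) ^ n * ((real n + 2) * gegenbauer a (n + 2) x)"
    unfolding gegenbauer_recurrence using 3 by (simp add: algebra_simps)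
  then show ?case by simp
qed auto

lemma gegenbauer_at_1_Suc:
  "(real n + 1) * gegenbauer (1/4) (Suc n) 1 = (real n + 1/2) * gegenbauer (1/4) n 1"
proof (induction n)
  case (Suc n)
  then show ?case
    using gegenbauer_recurrence[of n "1/4" 1] by (simp add: algebra_simps)
qed simp

lemma h_const_pos: "h_const n > 0"
  unfolding h_const_def by (intro divide_pos_pos mult_pos_pos zero_less_power Gamma_real_pos) auto

lemma h_const_Suc:
  "(real n + 1) * (real n + 5/4) * h_const (Suc n) = (real n + 1/4) * (real n + 1/2) * h_const n"
proof -
  have "(real n + 1) * gram (n + 1) (n + 1) * (real n + 5/4) = (real n + 1/4) * ((real n + 1/2) * gram n n)"
    unfolding gram_mult_cos(1) gram_mult_cos(2) by algebra
  then show ?thesis by (simp add: gram_diag mult_ac)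
qed

definition endval :: "nat \<Rightarrow> real" where
  "endval n = h_const n powr (-1/2) * gegenbauer (1/4) n 1"

lemma Phi_endpoints: "Phi n 0 = complex_of_real (endval n)" "Phi n pi = complex_of_real ((-1) ^ n * endval n)"
  using gegenbauer_minus[of "1/4" n 1] by (simp_all add: Phi_def endval_def)

lemma endval_sq: "(endval n)\<^sup>2 = (gegenbauer (1/4) n 1)\<^sup>2 / h_const n"
proof -
  have "(h_const n powr (-1/2))\<^sup>2 = h_const n powr (-1/2) * h_const n powr (-1/2)"
    by (simp add: power2_eq_square)
  also have "\<dots> = 1 / h_const n"
    using h_const_pos[of n] by (simp add: powr_add[symmetric] powr_minus_divide)
  finally show ?thesis by (simp add: endval_def power_mult_distrib)
qed

text \<open>The ratio of consecutive squares lies between \<open>1\<close> and \<open>5/2\<close>. Hence the endpoint values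
  never decrease, and they grow at most exponentially.\<close>

lemma endval_sq_Suc:
  "(real n + 1) * (real n + 1/4) * (endval (Suc n))\<^sup>2 = (real n + 1/2) * (real n + 5/4) * (endval n)\<^sup>2"
proof -
  let ?u = "gegenbauer (1/4) n 1" and ?v = "gegenbauer (1/4) (Suc n) 1"
  have v: "?v = (real n + 1/2) * ?u / (real n + 1)"
    using gegenbauer_at_1_Suc[of n] by (simp add: field_simps)
  have p: "(real n + 1) * (real n + 5/4) > 0" by (intro mult_pos_pos) auto
  have h: "h_const (Suc n) = (real n + 1/4) * (real n + 1/2) * h_const n / ((real n + 1) * (real n + 5/4))"
    using h_const_Suc[of n] p by (subst nonzero_eq_divide_eq) (simp, metis mult.commute)
  show ?thesis
    unfolding endval_sq v h using h_const_pos[of n]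
    by (simp add: divide_simps power2_eq_square) (simp add: algebra_simps)
qed

text \<open>The first squared endpoint value is the reciprocal of the integral of the weight, which lies between
  \<open>2\<close> and \<open>4\<close> because \<open>sin \<le> \<omega> \<le> 1\<close>.\<close>

lemma endval_0_bounds: "1 / 4 \<le> (endval 0)\<^sup>2" "(endval 0)\<^sup>2 \<le> 1"
proof -
  have i: "weight integrable_on {0..pi}" by (intro integrable_continuous_interval continuous_intros)
  have s: "(sin has_integral (- cos pi - (- cos 0))) {0..pi}"
    by (rule fundamental_theorem_of_calculus)
       (auto intro!: derivative_eq_intros simp flip: has_real_derivative_iff_has_vector_derivative)
  have h: "h_const 0 = integral {0..pi} weight"
    unfolding gram_diag[symmetric] gram_def by simp
  have w: "sin x \<le> weight x" "weight x \<le> 1" if "x \<in> {0..pi}" for x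
  proof -
    have "0 \<le> sin x" using that by (simp add: sin_ge_zero)
    moreover have "sin x \<le> 1" by simp
    ultimately have "(sin x)\<^sup>2 \<le> sin x" by (simp add: power2_eq_square mult_left_le)
    then show "sin x \<le> weight x" unfolding weight_def by (rule real_le_rsqrt)
    show "weight x \<le> 1" unfolding weight_def by simp
  qed
  have "2 \<le> integral {0..pi} weight"
    using has_integral_le[OF s integrable_integral[OF i]] w by simp
  moreover have "integral {0..pi} weight \<le> integral {0..pi} (\<lambda>x. 1)"
    using w by (intro integral_le i) auto
  then have "integral {0..pi} weight \<le> 4" using pi_less_4 by simp
  ultimately show "1 / 4 \<le> (endval 0)\<^sup>2" "(endval 0)\<^sup>2 \<le> 1"
    unfolding endval_sq h by (simp_all add: divide_simps)
qed

lemma endval_lower: "1 / 4 \<le> (endval n)\<^sup>2"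
proof (induction n)
  case (Suc n)
  let ?p = "(real n + 1) * (real n + 1/4)" and ?q = "(real n + 1/2) * (real n + 5/4)"
  have "?q - ?p = real n / 2 + 3 / 8" by (simp add: field_simps)
  then have "?p * (endval n)\<^sup>2 \<le> ?q * (endval n)\<^sup>2"
    by (intro mult_right_mono) (use of_nat_0_le_iff[of n] in linarith, simp)
  also have "\<dots> = ?p * (endval (Suc n))\<^sup>2" by (rule endval_sq_Suc[symmetric])
  finally have "(endval n)\<^sup>2 \<le> (endval (Suc n))\<^sup>2"
    by (subst (asm) mult_le_cancel_left_pos) auto
  with Suc show ?case by simp
qed (rule endval_0_bounds)

lemma endval_upper: "(endval n)\<^sup>2 \<le> exp (real n)"
proof (induction n)
  case (Suc n)
  let ?p = "(real n + 1) * (real n + 1/4)" and ?q = "(real n + 1/2) * (real n + 5/4)"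
  have e: "5/2 \<le> exp (1 :: real)" using exp_lower_Taylor_quadratic[of 1] by simp
  have "5/2 * ?p - ?q = 3/2 * (real n * real n) + 11/8 * real n" by (simp add: field_simps)
  moreover have "0 \<le> real n * real n" "0 \<le> real n" by auto
  ultimately have pq: "?q \<le> 5/2 * ?p" by linarith
  have "?p * (endval (Suc n))\<^sup>2 = ?q * (endval n)\<^sup>2" by (rule endval_sq_Suc)
  also have "\<dots> \<le> (5/2 * ?p) * (endval n)\<^sup>2"
    by (intro mult_right_mono pq) auto
  also have "\<dots> \<le> (exp 1 * ?p) * exp (real n)"
    by (intro mult_mono Suc e) auto
  finally have "?p * (endval (Suc n))\<^sup>2 \<le> ?p * exp (real (Suc n))"
    by (simp add: exp_add mult_ac)
  then show ?case by (subst (asm) mult_le_cancel_left_pos) auto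
qed (use endval_0_bounds in simp)

section \<open>Coordinates in the polynomial space\<close>

lemma integrable_lebesgue_on_open_interval:
  fixes f :: "real \<Rightarrow> 'a::euclidean_space"
  assumes "continuous_on {a..b} f"
  shows "integrable (lebesgue_on {a<..<b}) f"
proof -
  have "set_integrable lebesgue {a..b} f"
    using assms by (rule absolutely_integrable_continuous_real)
  then have "set_integrable lebesgue {a<..<b} f"
    by (rule set_integrable_subset) auto
  then show ?thesis
    by (simp add: integrable_restrict_space set_integrable_def)
qed

lemma continuous_on_Phi [continuous_intros]: "continuous_on S (Phi n)"
  unfolding Phi_def[abs_def] by (intro continuous_intros)

definition phi_sum :: "nat \<Rightarrow> (nat \<Rightarrow> complex) \<Rightarrow> real \<Rightarrow> complex" where
  "phi_sum N c x = (\<Sum>n\<le>N. c n * Phi n x)"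

lemma HN_iff: "f \<in> HN N \<longleftrightarrow> (\<exists>c. f = phi_sum N c)"
  unfolding HN_def phi_sum_def[abs_def] by auto

lemma phi_sum_in_HN [simp]: "phi_sum N c \<in> HN N"
  by (auto simp: HN_iff)

lemma innerH_Phi: "innerH (Phi n) (Phi m) = (if n = m then 1 else 0)"
proof -
  let ?k = "h_const n powr (-1/2) * h_const m powr (-1/2)"
  have "innerH (Phi n) (Phi m) = (LINT x|lebesgue_on {0<..<pi}. complex_of_real (?k * (weight x * geg n x * geg m x)))"
    unfolding innerH_def Phi_def by (intro Bochner_Integration.integral_cong) (auto simp: mult_ac)
  also have "\<dots> = complex_of_real (LINT x|lebesgue_on {0<..<pi}. ?k * (weight x * geg n x * geg m x))"
    by (rule integral_complex_of_real)
  also have "(LINT x|lebesgue_on {0<..<pi}. ?k * (weight x * geg n x * geg m x)) =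
      integral {0<..<pi} (\<lambda>x. ?k * (weight x * geg n x * geg m x))"
    by (intro lebesgue_integral_eq_integral integrable_lebesgue_on_open_interval continuous_intros) auto
  also have "\<dots> = ?k * gram n m"
    unfolding gram_def integral_open_interval_real by simp
  also have "\<dots> = (if n = m then 1 else 0)"
    using h_const_pos[of n]
    by (auto simp: gram_diag gram_orthogonal powr_add[symmetric] powr_minus_divide)
  finally show ?thesis by simp
qed

lemma innerH_phi_sum: "innerH (phi_sum N c) (phi_sum N d) = (\<Sum>n\<le>N. c n * cnj (d n))"
proof -
  have i: "integrable (lebesgue_on {0<..<pi}) (\<lambda>x. c n * cnj (d m) * (Phi n x * cnj (Phi m x) * complex_of_real (weight x)))" for n m
    by (intro integrable_lebesgue_on_open_interval continuous_intros)
  have "innerH (phi_sum N c) (phi_sum N d) =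
     (LINT x|lebesgue_on {0<..<pi}. (\<Sum>n\<le>N. \<Sum>m\<le>N. c n * cnj (d m) * (Phi n x * cnj (Phi m x) * complex_of_real (weight x))))"
    unfolding innerH_def phi_sum_def cnj_sum sum_product
    unfolding sum_distrib_right
    by (intro Bochner_Integration.integral_cong sum.cong refl) (simp add: mult_ac)
  also have "\<dots> = (\<Sum>n\<le>N. \<Sum>m\<le>N. c n * cnj (d m) * innerH (Phi n) (Phi m))"
    using i by (simp add: innerH_def)
  also have "\<dots> = (\<Sum>n\<le>N. c n * cnj (d n))"
    by (simp add: innerH_Phi if_distrib[of "(*) _"] cong: if_cong)
  finally show ?thesis .
qed

lemma Phi_eq_phi_sum: "m \<le> N \<Longrightarrow> Phi m = phi_sum N (\<lambda>n. if n = m then 1 else 0)"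
  by (intro ext) (simp add: phi_sum_def if_distrib[of "\<lambda>c. c * _"] cong: if_cong)

lemma phi_sum_extend: "N \<le> M \<Longrightarrow> phi_sum N c = phi_sum M (\<lambda>n. if n \<le> N then c n else 0)"
  unfolding phi_sum_def[abs_def]
  by (intro ext sum.mono_neutral_cong_left) auto

lemma innerH_phi_sum_Phi: "innerH (phi_sum N c) (Phi m) = (if m \<le> N then c m else 0)"
proof -
  have "innerH (phi_sum N c) (Phi m) =
      innerH (phi_sum (max N m) (\<lambda>n. if n \<le> N then c n else 0)) (phi_sum (max N m) (\<lambda>n. if n = m then 1 else 0))"
    by (subst Phi_eq_phi_sum[of m "max N m"], simp, subst phi_sum_extend[of N "max N m"]) simp_all
  also have "\<dots> = (if m \<le> N then c m else 0)"
    unfolding innerH_phi_sum by (simp add: if_distrib[of cnj] if_distrib[of "(*) _"] cong: if_cong)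
  finally show ?thesis .
qed

lemma HN_expand: "f \<in> HN N \<Longrightarrow> f = phi_sum N (\<lambda>n. innerH f (Phi n))"
  by (auto simp: HN_iff innerH_phi_sum_Phi phi_sum_def intro!: sum.cong)

lemma Phi_in_HN: "n \<le> N \<Longrightarrow> Phi n \<in> HN N"
  by (metis Phi_eq_phi_sum phi_sum_in_HN)

lemma normH_phi_sum: "normH (phi_sum N c) = sqrt (\<Sum>n\<le>N. (cmod (c n))\<^sup>2)"
  unfolding normH_def innerH_phi_sum by (simp add: complex_norm_square[symmetric] flip: of_real_sum of_real_power)

lemma normH_sq_phi_sum: "(normH (phi_sum N c))\<^sup>2 = (\<Sum>n\<le>N. (cmod (c n))\<^sup>2)"
  by (simp add: normH_phi_sum sum_nonneg)

lemma cmod_coeff_le_normH: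
  assumes "f \<in> HN N" "n \<le> N"
  shows "cmod (innerH f (Phi n)) \<le> normH f"
proof -
  obtain c where f: "f = phi_sum N c" using assms by (auto simp: HN_iff)
  have "(cmod (c n))\<^sup>2 \<le> (\<Sum>n\<le>N. (cmod (c n))\<^sup>2)"
    using assms(2) by (intro member_le_sum) auto
  then show ?thesis
    unfolding f normH_phi_sum using assms(2) by (simp add: innerH_phi_sum_Phi real_le_rsqrt)
qed

lemma diag_op_HN:
  assumes "f \<in> HN N"
  shows "diag_op m f = phi_sum N (\<lambda>n. complex_of_real (m n) * innerH f (Phi n))"
proof
  fix x
  obtain c where f: "f = phi_sum N c" using assms by (auto simp: HN_iff)
  have "diag_op m f x = (\<Sum>n\<le>N. complex_of_real (m n) * innerH f (Phi n) * Phi n x)"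
    unfolding diag_op_def by (rule suminf_finite) (auto simp: f innerH_phi_sum_Phi)
  then show "diag_op m f x = phi_sum N (\<lambda>n. complex_of_real (m n) * innerH f (Phi n)) x"
    by (simp add: phi_sum_def)
qed

lemma phi_sum_eqD:
  assumes "\<And>x. x \<in> {0..pi} \<Longrightarrow> phi_sum N c x = phi_sum N d x" "n \<le> N"
  shows "c n = d n"
proof -
  have "innerH (phi_sum N c) (Phi n) = innerH (phi_sum N d) (Phi n)"
    unfolding innerH_def using assms(1) by (intro Bochner_Integration.integral_cong) auto
  then show ?thesis using assms(2) by (simp add: innerH_phi_sum_Phi)
qed

text \<open>The functions \<open>Phi n\<close> are real, so the coefficient of \<open>C_adj N v\<close> along \<open>Phi n\<close> is \<open>v\<close> tested against
  the endpoint values of \<open>Phi n\<close>. Since the coefficients determine an element of \<open>HN N\<close>, this is the only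
  candidate for the adjoint.\<close>

lemma C_adj_eq: "C_adj N v = phi_sum N (\<lambda>n. Phi n 0 * v $ 1 + Phi n pi * v $ 2)"
  unfolding C_adj_def
proof (rule the_equality)
  let ?g = "phi_sum N (\<lambda>n. Phi n 0 * v $ 1 + Phi n pi * v $ 2)"
  have cP: "cnj (Phi n x) = Phi n x" for n x by (simp add: Phi_def)
  have obs: "inner_C2 (C_obs f) v = f 0 * cnj (v $ 1) + f pi * cnj (v $ 2)" for f
    by (simp add: inner_C2_def C_obs_def sum_2)
  show "?g \<in> HN N \<and> (\<forall>f\<in>HN N. inner_C2 (C_obs f) v = innerH f ?g)"
  proof (intro conjI ballI)
    fix f assume "f \<in> HN N"
    then obtain c where f: "f = phi_sum N c" by (auto simp: HN_iff)
    show "inner_C2 (C_obs f) v = innerH f ?g"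
      unfolding obs f innerH_phi_sum
      by (simp add: phi_sum_def cP sum_distrib_left sum_distrib_right distrib_left sum.distrib mult_ac)
  qed simp
  fix g assume g: "g \<in> HN N \<and> (\<forall>f\<in>HN N. inner_C2 (C_obs f) v = innerH f g)"
  then obtain c where gc: "g = phi_sum N c" by (auto simp: HN_iff)
  have "c n = Phi n 0 * v $ 1 + Phi n pi * v $ 2" if "n \<le> N" for n
  proof -
    have "inner_C2 (C_obs (Phi n)) v = innerH (Phi n) g"
      using g Phi_in_HN[OF that] by blast
    also have "\<dots> = cnj (c n)"
      using that unfolding gc by (subst Phi_eq_phi_sum[OF that])
        (simp add: innerH_phi_sum if_distrib[of "\<lambda>x. x * _"] cong: if_cong)
    finally have "c n = cnj (Phi n 0 * cnj (v $ 1) + Phi n pi * cnj (v $ 2))"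
      by (simp add: obs)
    then show ?thesis by (simp add: cP)
  qed
  then show "g = ?g" unfolding gc phi_sum_def[abs_def] by simp
qed

section \<open>Recovering the coefficients of an exponential sum\<close>

lemma integral_norm_shift_diff_le:
  fixes u :: "real \<Rightarrow> complex"
  assumes u: "continuous_on UNIV u" and h: "0 \<le> h" and r: "0 \<le> r"
  shows "integral {0..L} (\<lambda>t. cmod (u (t + h) - of_real r * u t)) \<le> (1 + r) * integral {0..L + h} (\<lambda>t. cmod (u t))"
proof -
  have cu: "continuous_on S u" for S using u continuous_on_subset by blast
  have i: "(\<lambda>t. cmod (u t)) integrable_on {a..b}" for a b
    by (intro integrable_continuous_interval continuous_intros cu)
  have sh: "integral {0..L} (\<lambda>t. cmod (u (t + h))) = integral {0 + h..L + h} (\<lambda>t. cmod (u t))"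
    using integral_shift[of 0 h L "\<lambda>t. cmod (u t)"] cu
    by (simp add: o_def continuous_on_norm)
  have j: "(\<lambda>t. cmod (u (t + h))) integrable_on {0..L}"
    by (intro integrable_continuous_interval continuous_intros continuous_on_compose2[OF u]) auto
  have "integral {0..L} (\<lambda>t. cmod (u (t + h) - of_real r * u t)) \<le>
      integral {0..L} (\<lambda>t. cmod (u (t + h)) + r * cmod (u t))"
  proof (rule integral_le)
    show "(\<lambda>t. cmod (u (t + h) - of_real r * u t)) integrable_on {0..L}"
      by (intro integrable_continuous_interval continuous_intros continuous_on_compose2[OF u] cu) auto
    show "(\<lambda>t. cmod (u (t + h)) + r * cmod (u t)) integrable_on {0..L}"
      by (intro integrable_add j integrable_on_mult_right i)
    fix t show "cmod (u (t + h) - of_real r * u t) \<le> cmod (u (t + h)) + r * cmod (u t)"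
      using norm_triangle_ineq4[of "u (t + h)" "of_real r * u t"] r by (simp add: norm_mult)
  qed
  also have "\<dots> = integral {0 + h..L + h} (\<lambda>t. cmod (u t)) + r * integral {0..L} (\<lambda>t. cmod (u t))"
    by (subst integral_add) (auto intro!: j integrable_on_mult_right i simp: sh)
  also have "\<dots> \<le> integral {0..L + h} (\<lambda>t. cmod (u t)) + r * integral {0..L + h} (\<lambda>t. cmod (u t))"
    by (intro add_mono mult_left_mono integral_subset_le i r) (use h in auto)
  finally show ?thesis by (simp add: algebra_simps)
qed

text \<open>By induction on the set of frequencies to be removed. The difference operator for \<open>j\<close> kills
  \<open>exp (\<kappa> j * t)\<close> and keeps the other exponentials; it shortens the interval by \<open>h\<close> and its norm on
  integrals is at most \<open>1 + exp (\<kappa> j * h)\<close>.\<close>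

lemma exp_sum_coefficient_bound:
  fixes \<kappa> :: "'a \<Rightarrow> real" and c :: "'a \<Rightarrow> complex"
  assumes "finite K" "i \<notin> K" "0 \<le> h"
  shows "cmod (c i) * (\<Prod>j\<in>K. \<bar>exp (\<kappa> i * h) - exp (\<kappa> j * h)\<bar>) * integral {0..L} (\<lambda>t. exp (\<kappa> i * t))
    \<le> (\<Prod>j\<in>K. 1 + exp (\<kappa> j * h)) *
       integral {0..L + h * card K} (\<lambda>t. cmod (\<Sum>k\<in>insert i K. c k * of_real (exp (\<kappa> k * t))))"
  using assms
proof (induction K arbitrary: c rule: finite_induct)
  case empty
  then show ?case by (simp add: norm_mult)
next
  case (insert j K)
  define u where "u t = (\<Sum>k\<in>insert i (insert j K). c k * of_real (exp (\<kappa> k * t)))" for t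
  define c' where "c' k = c k * of_real (exp (\<kappa> k * h) - exp (\<kappa> j * h))" for k
  have v: "u (t + h) - of_real (exp (\<kappa> j * h)) * u t = (\<Sum>k\<in>insert i K. c' k * of_real (exp (\<kappa> k * t)))" for t
  proof -
    have "u (t + h) - of_real (exp (\<kappa> j * h)) * u t = (\<Sum>k\<in>insert i (insert j K). c' k * of_real (exp (\<kappa> k * t)))"
      unfolding u_def sum_distrib_left sum_subtractf[symmetric]
      by (intro sum.cong refl) (simp add: c'_def distrib_left exp_add algebra_simps)
    also have "\<dots> = (\<Sum>k\<in>insert i K. c' k * of_real (exp (\<kappa> k * t)))"
      using insert by (intro sum.mono_neutral_right) (auto simp: c'_def)
    finally show ?thesis .
  qed
  have ucont: "continuous_on UNIV u"
    unfolding u_def[abs_def] by (intro continuous_intros)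
  have "cmod (c i) * (\<Prod>k\<in>insert j K. \<bar>exp (\<kappa> i * h) - exp (\<kappa> k * h)\<bar>) * integral {0..L} (\<lambda>t. exp (\<kappa> i * t))
     = cmod (c' i) * (\<Prod>k\<in>K. \<bar>exp (\<kappa> i * h) - exp (\<kappa> k * h)\<bar>) * integral {0..L} (\<lambda>t. exp (\<kappa> i * t))"
    using insert by (simp add: c'_def norm_mult mult_ac flip: of_real_diff)
  also have "\<dots> \<le> (\<Prod>k\<in>K. 1 + exp (\<kappa> k * h)) *
      integral {0..L + h * card K} (\<lambda>t. cmod (\<Sum>k\<in>insert i K. c' k * of_real (exp (\<kappa> k * t))))"
    using insert by auto
  also have "\<dots> \<le> (\<Prod>k\<in>K. 1 + exp (\<kappa> k * h)) *
      ((1 + exp (\<kappa> j * h)) * integral {0..L + h * card K + h} (\<lambda>t. cmod (u t)))"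
    unfolding v[symmetric] using insert
    by (intro mult_left_mono integral_norm_shift_diff_le ucont prod_nonneg) (auto intro: add_nonneg_nonneg)
  also have "\<dots> = (\<Prod>k\<in>insert j K. 1 + exp (\<kappa> k * h)) *
      integral {0..L + h * card (insert j K)} (\<lambda>t. cmod (u t))"
    using insert by (simp add: algebra_simps)
  finally show ?case unfolding u_def .
qed

lemma prod_distance_eq_fact:
  assumes "i \<le> M"
  shows "(\<Prod>j\<in>{..M} - {i}. \<bar>real i - real j\<bar>) = fact i * fact (M - i)"
proof -
  have D: "{..M} - {i} = {..<i} \<union> {i<..M}" using assms by auto
  have "(\<Prod>j\<in>{..M} - {i}. \<bar>real i - real j\<bar>) = (\<Prod>j\<in>{..<i}. \<bar>real i - real j\<bar>) * (\<Prod>j\<in>{i<..M}. \<bar>real i - real j\<bar>)"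
    unfolding D by (rule prod.union_disjoint) auto
  also have "(\<Prod>j\<in>{..<i}. \<bar>real i - real j\<bar>) = (\<Prod>k\<in>{1..i}. real k)"
    by (rule prod.reindex_bij_witness[where i = "\<lambda>k. i - k" and j = "\<lambda>j. i - j"]) auto
  also have "\<dots> = fact i" by (simp add: fact_prod)
  also have "(\<Prod>j\<in>{i<..M}. \<bar>real i - real j\<bar>) = (\<Prod>k\<in>{1..M - i}. real k)"
    by (rule prod.reindex_bij_witness[where i = "\<lambda>k. i + k" and j = "\<lambda>j. j - i"]) auto
  also have "\<dots> = fact (M - i)" by (simp add: fact_prod)
  finally show ?thesis .
qed

lemma fact_mult_fact_lower:
  assumes "i \<le> M"
  shows "fact M / 2 ^ M \<le> (fact i * fact (M - i) :: real)"
proof -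
  have "M choose i \<le> 2 ^ M"
    by (rule binomial_le_pow2)
  then have "real (M choose i) \<le> 2 ^ M" by (metis of_nat_le_iff of_nat_numeral of_nat_power)
  then have "fact i * fact (M - i) * real (M choose i) \<le> fact i * fact (M - i) * 2 ^ M"
    by (intro mult_left_mono) auto
  also have "fact i * fact (M - i) * real (M choose i) = fact M"
    using binomial_fact_lemma[OF assms] by (metis of_nat_fact of_nat_mult)
  finally show ?thesis by (simp add: field_simps)
qed

lemma power_le_fact_mult_exp:
  assumes "0 \<le> (x :: real)"
  shows "x ^ n \<le> fact n * exp x"
proof -
  have s: "(\<lambda>k. x ^ k /\<^sub>R fact k) sums exp x" by (rule exp_converges)
  have "x ^ n /\<^sub>R fact n \<le> exp x"
    using assms sum_le_suminf[OF sums_summable[OF s], of "{n}"]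
    by (simp add: sums_unique[OF s])
  then show ?thesis by (simp add: field_simps)
qed

text \<open>On \<open>{-1/2..}\<close> the derivative of the exponential function is at least \<open>1/2\<close>.\<close>

lemma abs_exp_diff_ge:
  assumes "-1/2 \<le> a" "-1/2 \<le> (b :: real)"
  shows "\<bar>a - b\<bar> / 2 \<le> \<bar>exp a - exp b\<bar>"
proof -
  have *: "(a - b) / 2 \<le> exp a - exp b" if "-1/2 \<le> b" "b \<le> a" for a b :: real
  proof -
    have "1/2 \<le> exp b" using exp_ge_add_one_self[of b] that by linarith
    moreover have "a - b \<le> exp (a - b) - 1" using exp_ge_add_one_self[of "a - b"] by linarith
    ultimately have "1/2 * (a - b) \<le> exp b * (exp (a - b) - 1)"
      using that by (intro mult_mono) auto
    also have "\<dots> = exp a - exp b" by (simp add: exp_diff algebra_simps)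
    finally show ?thesis by simp
  qed
  show ?thesis using *[of b a] *[of a b] assms by (cases "b \<le> a") auto
qed

text \<open>An enumeration of all characteristic roots: \<open>2n\<close> sits at the even index \<open>2n\<close> and \<open>-(2n + 1)\<close> at
  the odd index \<open>2n + 1\<close>. Thus \<open>m div 2\<close> is the mode of index \<open>m\<close>, and frequencies are separated at least
  as well as their indices.\<close>

definition freq :: "nat \<Rightarrow> real" where
  "freq m = (-1) ^ m * real m"

lemma abs_freq [simp]: "\<bar>freq m\<bar> = real m"
  by (simp add: freq_def abs_mult)

lemma freq_separated: "\<bar>real i - real j\<bar> \<le> \<bar>freq i - freq j\<bar>"
  by (cases "even i"; cases "even j") (auto simp: freq_def)

text \<open>The previous estimate with \<open>h = 1 / (2 (M + 1))\<close>: the \<open>M\<close> shifts then use up at most half of the unit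
  interval and all \<open>freq m * h\<close> stay in \<open>{-1/2..1/2}\<close>. The differences of exponentials are bounded
  below by \<open>h / 2\<close> times distances of integers, whose product \<open>i! (M - i)! \<ge> M! / 2^M\<close>
  compensates \<open>(h / 2)^M\<close> up to a factor exponential in \<open>M\<close>.\<close>

lemma freq_coefficient_bound:
  fixes c :: "nat \<Rightarrow> complex"
  assumes i: "i \<le> M"
  shows "cmod (c i) \<le> exp (7 * (real M + 1)) * integral {0..1} (\<lambda>t. cmod (\<Sum>m\<le>M. c m * of_real (exp (freq m * t))))"
proof -
  define h where "h = 1 / (2 * (real M + 1))"
  define K where "K = {..M} - {i}"
  have h: "0 < h" by (simp add: h_def)
  have K: "finite K" "i \<notin> K" "insert i K = {..M}" "card K = M"
    using i by (auto simp: K_def)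
  have fh: "\<bar>freq m * h\<bar> \<le> 1/2" if "m \<le> M" for m
    using that by (simp add: abs_mult h_def field_simps)
  have e1: "(2 :: real) \<le> exp 1" using exp_ge_add_one_self[of 1] by simp
  have e2: "exp (1/2 :: real) \<le> 2"
    using exp_ge_add_one_self[of "-1/2"] by (simp add: exp_minus field_simps)
  let ?U = "\<lambda>b. integral {0..b} (\<lambda>t. cmod (\<Sum>m\<le>M. c m * of_real (exp (freq m * t))))"
  have cont: "(\<lambda>t. cmod (\<Sum>m\<le>M. c m * of_real (exp (freq m * t)))) integrable_on {a..b}" for a b
    by (intro integrable_continuous_interval continuous_intros)
  have "exp (- (4 * (real M + 1))) \<le> (\<Prod>j\<in>K. \<bar>exp (freq i * h) - exp (freq j * h)\<bar>)"
  proof -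
    have "(2 :: real) ^ 3 \<le> exp 1 ^ 3" using e1 by (intro power_mono) auto
    then have e3: "8 \<le> exp (3 :: real)" by (simp flip: exp_of_nat_mult)
    have "8 ^ M \<le> exp (3 * real M)"
      using power_mono[OF e3, of M] by (simp add: exp_of_nat_mult[symmetric] mult.commute)
    have p: "(real M + 1) ^ M \<le> fact M * exp (real M + 1)"
      by (rule power_le_fact_mult_exp) simp
    have "exp (3 * real M) * exp (real M + 1) = exp (4 * real M + 1)"
      by (simp flip: exp_add)
    then have "1 / (exp (3 * real M) * exp (real M + 1)) = exp (- (4 * real M + 1))"
      by (simp only: exp_minus inverse_eq_divide)
    then have "exp (- (4 * (real M + 1))) \<le> 1 / (exp (3 * real M) * exp (real M + 1))"
      by simp
    also have "\<dots> \<le> 1 / (8 ^ M * exp (real M + 1))"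
      by (intro divide_left_mono mult_right_mono \<open>8 ^ M \<le> exp (3 * real M)\<close>) auto
    also have "\<dots> \<le> fact M / (8 ^ M * (real M + 1) ^ M)"
      using p by (simp add: divide_simps mult_ac)
    also have "\<dots> = (h / 2) ^ M * (fact M / 2 ^ M)"
      by (simp add: h_def power_divide power_mult_distrib[symmetric] mult_ac)
    also have "\<dots> \<le> (h / 2) ^ M * (fact i * fact (M - i))"
      using h by (intro mult_left_mono fact_mult_fact_lower i) auto
    also have "\<dots> = (\<Prod>j\<in>K. h / 2 * \<bar>real i - real j\<bar>)"
      unfolding prod_distance_eq_fact[OF i, symmetric] prod.distrib K_def[symmetric] by (simp add: K)
    also have "\<dots> \<le> (\<Prod>j\<in>K. \<bar>exp (freq i * h) - exp (freq j * h)\<bar>)"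
    proof (intro prod_mono conjI)
      fix j assume "j \<in> K"
      then have j: "j \<le> M" by (auto simp: K_def)
      have "h / 2 * \<bar>real i - real j\<bar> \<le> h / 2 * \<bar>freq i - freq j\<bar>"
        using h by (intro mult_left_mono freq_separated) auto
      also have "\<dots> = \<bar>freq i * h - freq j * h\<bar> / 2"
        using h by (simp add: abs_mult flip: left_diff_distrib)
      also have "\<dots> \<le> \<bar>exp (freq i * h) - exp (freq j * h)\<bar>"
        using fh[OF i] fh[OF j] by (intro abs_exp_diff_ge) linarith+
      finally show "h / 2 * \<bar>real i - real j\<bar> \<le> \<bar>exp (freq i * h) - exp (freq j * h)\<bar>" .
    qed (use h in auto)
    finally show ?thesis .
  qed
  moreover have "exp (- (real M + 1)) \<le> integral {0..1/2} (\<lambda>t. exp (freq i * t))"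
  proof -
    have "exp (- (real M + 1)) = exp (- real M) * exp (-1)" by (simp flip: exp_add)
    also have "\<dots> \<le> exp (- real M) * (1/2)"
      using e1 by (intro mult_left_mono) (auto simp: exp_minus divide_simps)
    also have "\<dots> = integral {0..1/2 :: real} (\<lambda>t. exp (- real M))" by simp
    also have "\<dots> \<le> integral {0..1/2} (\<lambda>t. exp (freq i * t))"
    proof (intro integral_le integrable_continuous_interval continuous_intros)
      fix t :: real assume t: "t \<in> {0..1/2}"
      have "\<bar>freq i * t\<bar> \<le> real M * 1"
        unfolding abs_mult abs_freq using t i by (intro mult_mono) auto
      then show "exp (- real M) \<le> exp (freq i * t)" by simp
    qed
    finally show ?thesis .
  qed
  ultimately have low: "exp (- (4 * (real M + 1))) * exp (- (real M + 1)) \<le>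
      (\<Prod>j\<in>K. \<bar>exp (freq i * h) - exp (freq j * h)\<bar>) * integral {0..1/2} (\<lambda>t. exp (freq i * t))"
    by (intro mult_mono prod_nonneg) auto
  have up: "(\<Prod>j\<in>K. 1 + exp (freq j * h)) \<le> exp (2 * (real M + 1))"
  proof -
    have "(\<Prod>j\<in>K. 1 + exp (freq j * h)) \<le> (\<Prod>j\<in>K. exp 2)"
    proof (intro prod_mono conjI)
      fix j assume "j \<in> K"
      then have "freq j * h \<le> 1/2" using fh[of j] by (auto simp: K_def)
      then have "exp (freq j * h) \<le> exp (1/2)" by simp
      also note e2
      finally show "1 + exp (freq j * h) \<le> exp 2"
        using exp_ge_add_one_self[of 2] by linarith
    qed (auto intro: add_nonneg_nonneg)
    also have "\<dots> = exp (2 * real M)"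
      by (simp add: K exp_of_nat_mult[symmetric] mult.commute)
    also have "\<dots> \<le> exp (2 * (real M + 1))" by simp
    finally show ?thesis .
  qed
  have "cmod (c i) * (exp (- (4 * (real M + 1))) * exp (- (real M + 1))) \<le>
     cmod (c i) * (\<Prod>j\<in>K. \<bar>exp (freq i * h) - exp (freq j * h)\<bar>) * integral {0..1/2} (\<lambda>t. exp (freq i * t))"
    unfolding mult.assoc by (intro mult_left_mono low) auto
  also have "\<dots> \<le> (\<Prod>j\<in>K. 1 + exp (freq j * h)) * ?U (1/2 + h * M)"
    using exp_sum_coefficient_bound[OF K(1,2), of h c freq "1/2"] h unfolding K by simp
  also have "\<dots> \<le> exp (2 * (real M + 1)) * ?U 1"
    by (intro mult_mono up integral_subset_le cont integral_nonneg) (auto simp: h_def field_simps)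
  finally have "cmod (c i) * (exp (- (4 * (real M + 1))) * exp (- (real M + 1))) \<le> exp (2 * (real M + 1)) * ?U 1" .
  then have "cmod (c i) * exp (- (5 * (real M + 1))) \<le> exp (2 * (real M + 1)) * ?U 1"
    by (simp flip: exp_add)
  then have *: "cmod (c i) * exp (- (5 * (real M + 1))) * exp (5 * (real M + 1)) \<le> exp (2 * (real M + 1)) * ?U 1 * exp (5 * (real M + 1))"
    by (rule mult_right_mono) simp
  have "cmod (c i) = cmod (c i) * (exp (- (5 * (real M + 1))) * exp (5 * (real M + 1)))"
    by (simp flip: exp_add)
  also have "\<dots> \<le> exp (2 * (real M + 1)) * exp (5 * (real M + 1)) * ?U 1"
    using * by (simp only: mult_ac)
  also have "exp (2 * (real M + 1)) * exp (5 * (real M + 1)) = exp (7 * (real M + 1))"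
    by (simp flip: exp_add)
  finally show ?thesis .
qed

section \<open>Smooth cut-off functions\<close>

text \<open>These functions, flat to infinite order at \<open>0\<close>, form a family closed under differentiation; this
  is why an arbitrary polynomial in \<open>1 / y\<close> is allowed as a factor of \<open>exp (- 1 / y)\<close>.\<close>

definition flat_exp :: "real poly \<Rightarrow> real \<Rightarrow> real" where
  "flat_exp p y = (if y \<le> 0 then 0 else poly p (1 / y) * exp (- (1 / y)))"

lemma flat_exp_nonneg: "(\<And>y. 0 < y \<Longrightarrow> 0 \<le> poly p y) \<Longrightarrow> 0 \<le> flat_exp p x"
  by (simp add: flat_exp_def)

lemma flat_exp_tendsto_0: "(flat_exp p \<longlongrightarrow> 0) (at 0)"
proof -
  have "((\<lambda>z. poly p z * exp (- z)) \<longlongrightarrow> (\<Sum>i\<le>degree p. coeff p i * 0)) at_top"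
  proof -
    have "((\<lambda>z. \<Sum>i\<le>degree p. coeff p i * (z ^ i / exp z)) \<longlongrightarrow> (\<Sum>i\<le>degree p. coeff p i * 0)) at_top"
      by (intro tendsto_intros tendsto_power_div_exp_0)
    then show ?thesis
      by (simp add: poly_altdef sum_distrib_left sum_distrib_right exp_minus divide_inverse mult_ac)
  qed
  then have "((\<lambda>y. poly p (inverse y) * exp (- inverse y)) \<longlongrightarrow> 0) (at_right 0)"
    using filterlim_compose[OF _ filterlim_inverse_at_top_right] by simp
  then have "(flat_exp p \<longlongrightarrow> 0) (at_right 0)"
    by (rule Lim_transform_eventually)
       (auto simp: flat_exp_def eventually_at_filter inverse_eq_divide)
  moreover have "(flat_exp p \<longlongrightarrow> 0) (at_left 0)"
    by (rule tendsto_eventually) (auto simp: flat_exp_def eventually_at_filter)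
  ultimately show ?thesis by (simp add: filterlim_split_at)
qed

lemma flat_exp_has_derivative:
  "(flat_exp p has_real_derivative flat_exp ([:0, 0, 1:] * (p - pderiv p)) y) (at y)"
proof -
  consider "y < 0" | "y = 0" | "y > 0" by linarith
  then show ?thesis
  proof cases
    case 1
    have "((\<lambda>y :: real. 0 :: real) has_real_derivative 0) (at y)" by simp
    then have "(flat_exp p has_real_derivative 0) (at y)"
      by (rule has_field_derivative_transform_within_open[of _ _ _ "{..<0}"])
         (use 1 in \<open>auto simp: flat_exp_def\<close>)
    then show ?thesis using 1 by (simp add: flat_exp_def)
  next
    case 2
    have "(\<lambda>h. (flat_exp p (0 + h) - flat_exp p 0) / h) = flat_exp ([:0, 1:] * p)"
      by (auto simp: flat_exp_def fun_eq_iff)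
    then have "(flat_exp p has_real_derivative 0) (at 0)"
      unfolding DERIV_def using flat_exp_tendsto_0 by simp
    then show ?thesis using 2 by (simp add: flat_exp_def)
  next
    case 3
    have "((\<lambda>y. poly p (1 / y) * exp (- (1 / y))) has_real_derivative
       poly ([:0, 0, 1:] * (p - pderiv p)) (1 / y) * exp (- (1 / y))) (at y)"
      using 3 by (auto intro!: derivative_eq_intros simp: field_simps power2_eq_square)
    then have "(flat_exp p has_real_derivative poly ([:0, 0, 1:] * (p - pderiv p)) (1 / y) * exp (- (1 / y))) (at y)"
      by (rule has_field_derivative_transform_within_open[of _ _ _ "{0<..}"])
         (use 3 in \<open>auto simp: flat_exp_def\<close>)
    then show ?thesis using 3 by (simp add: flat_exp_def)
  qed
qed

lemma flat_exp_affine_has_derivative: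
  "((\<lambda>x. flat_exp p (a * x + b)) has_real_derivative flat_exp ([:0, 0, 1:] * (p - pderiv p)) (a * x + b) * a) (at x)"
  by (rule DERIV_chain2[OF flat_exp_has_derivative]) (auto intro!: derivative_eq_intros)

text \<open>A class of functions closed under differentiation, so that every member is infinitely
  differentiable without any computation of higher derivatives. Exponentials belong to it because
  test functions are multiplied by integrating factors.\<close>

inductive smooth_fun :: "(real \<Rightarrow> real) \<Rightarrow> bool" where
  smooth_flat: "smooth_fun (\<lambda>x. flat_exp p (a * x + b))"
| smooth_exp: "smooth_fun (\<lambda>x. c * exp (d * x))"
| smooth_add: "smooth_fun f \<Longrightarrow> smooth_fun g \<Longrightarrow> smooth_fun (\<lambda>x. f x + g x)"
| smooth_mult: "smooth_fun f \<Longrightarrow> smooth_fun g \<Longrightarrow> smooth_fun (\<lambda>x. f x * g x)"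
| smooth_inverse: "smooth_fun f \<Longrightarrow> (\<And>x. f x \<noteq> 0) \<Longrightarrow> smooth_fun (\<lambda>x. inverse (f x))"

lemma smooth_const: "smooth_fun (\<lambda>x. c)"
  using smooth_exp[of c 0] by simp

lemma smooth_has_derivative:
  assumes "smooth_fun f"
  shows "\<exists>g. smooth_fun g \<and> (\<forall>x. (f has_real_derivative g x) (at x))"
  using assms
proof induction
  case (smooth_flat p a b)
  show ?case
    by (intro exI[of _ "\<lambda>x. flat_exp ([:0, 0, 1:] * (p - pderiv p)) (a * x + b) * a"] conjI allI
        flat_exp_affine_has_derivative smooth_fun.smooth_mult smooth_fun.smooth_flat smooth_const)
next
  case (smooth_exp c d)
  show ?case
    by (intro exI[of _ "\<lambda>x. (c * d) * exp (d * x)"] conjI smooth_fun.smooth_exp)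
       (auto intro!: derivative_eq_intros)
next
  case (smooth_add f g)
  then obtain f' g' where "smooth_fun f'" "smooth_fun g'"
    "\<And>x. (f has_real_derivative f' x) (at x)" "\<And>x. (g has_real_derivative g' x) (at x)" by blast
  then show ?case
    by (intro exI[of _ "\<lambda>x. f' x + g' x"]) (auto intro!: smooth_fun.intros derivative_intros)
next
  case (smooth_mult f g)
  then obtain f' g' where "smooth_fun f'" "smooth_fun g'"
    "\<And>x. (f has_real_derivative f' x) (at x)" "\<And>x. (g has_real_derivative g' x) (at x)" by blast
  with smooth_mult(1,2) show ?case
    by (intro exI[of _ "\<lambda>x. f' x * g x + g' x * f x"]) (auto intro!: smooth_fun.intros DERIV_mult)
next
  case (smooth_inverse f)
  then obtain f' where f': "smooth_fun f'" "\<And>x. (f has_real_derivative f' x) (at x)" by blast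
  have "((\<lambda>x. inverse (f x)) has_real_derivative (-1) * (inverse (f x) * (f' x * inverse (f x)))) (at x)" for x
    using smooth_inverse.hyps(2)[of x] by (auto intro!: derivative_eq_intros f')
  with smooth_inverse(1,2) f' show ?case
    by (intro exI[of _ "\<lambda>x. (-1) * (inverse (f x) * (f' x * inverse (f x)))"] conjI allI
        smooth_fun.smooth_mult smooth_fun.smooth_inverse smooth_const) auto
qed

lemma smooth_deriv:
  assumes "smooth_fun f"
  shows "smooth_fun (deriv f)" "(f has_real_derivative deriv f x) (at x)"
proof -
  obtain g where g: "smooth_fun g" "\<And>x. (f has_real_derivative g x) (at x)"
    using smooth_has_derivative[OF assms] by blast
  then have "deriv f = g" by (auto intro!: DERIV_imp_deriv)
  with g show "smooth_fun (deriv f)" "(f has_real_derivative deriv f x) (at x)" by auto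
qed

lemma smooth_continuous:
  assumes "smooth_fun f" shows "continuous_on S f"
  using smooth_deriv(2)[OF assms] DERIV_isCont continuous_at_imp_continuous_on by blast

lemma smooth_iterated_deriv: "smooth_fun f \<Longrightarrow> smooth_fun ((deriv ^^ k) f)"
  by (induction k) (auto intro: smooth_deriv)

text \<open>A smooth function that rises from \<open>0\<close> to \<open>1\<close> between \<open>s\<close> and \<open>s + \<epsilon>\<close>. The affine arguments have the
  shape \<open>a * x + b\<close> of the introduction rule for \<^const>\<open>flat_exp\<close>.\<close>

definition smooth_step :: "real \<Rightarrow> real \<Rightarrow> real \<Rightarrow> real" where
  "smooth_step s \<epsilon> x = flat_exp 1 (1 * x + - s) * inverse (flat_exp 1 (1 * x + - s) + flat_exp 1 ((-1) * x + (s + \<epsilon>)))"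

lemma flat_exp_1: "0 \<le> flat_exp 1 y" "0 < y \<Longrightarrow> 0 < flat_exp 1 y" "y \<le> 0 \<Longrightarrow> flat_exp 1 y = 0"
  by (auto simp: flat_exp_def)

context
  fixes s \<epsilon> :: real
  assumes eps: "0 < \<epsilon>"
begin

lemma step_denom_pos: "0 < flat_exp 1 (1 * x + - s) + flat_exp 1 ((-1) * x + (s + \<epsilon>))"
proof (cases "s < x")
  case True
  then have "0 < flat_exp 1 (1 * x + - s)" by (intro flat_exp_1) simp
  then show ?thesis by (intro add_pos_nonneg flat_exp_1(1))
next
  case False
  then have "0 < flat_exp 1 ((-1) * x + (s + \<epsilon>))" using eps by (intro flat_exp_1) simp
  then show ?thesis by (intro add_nonneg_pos flat_exp_1(1))
qed

lemma smooth_smooth_step: "smooth_fun (smooth_step s \<epsilon>)"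
  unfolding smooth_step_def[abs_def]
  by (intro smooth_fun.intros) (use step_denom_pos in \<open>metis less_irrefl\<close>)

lemma smooth_step_left: "x \<le> s \<Longrightarrow> smooth_step s \<epsilon> x = 0"
  by (simp add: smooth_step_def flat_exp_1)

lemma smooth_step_right: "s + \<epsilon> \<le> x \<Longrightarrow> smooth_step s \<epsilon> x = 1"
  using step_denom_pos[of x] by (simp add: smooth_step_def flat_exp_1)

lemma smooth_step_bounds: "0 \<le> smooth_step s \<epsilon> x" "smooth_step s \<epsilon> x \<le> 1"
  using step_denom_pos[of x] flat_exp_1(1)[of "1 * x + - s"] flat_exp_1(1)[of "(-1) * x + (s + \<epsilon>)"]
  by (simp_all add: smooth_step_def divide_inverse[symmetric] divide_le_eq)

lemma deriv_smooth_step_nonneg: "0 \<le> deriv (smooth_step s \<epsilon>) x"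
proof -
  define q where "q = [:0, 0, 1 :: real:] * (1 - pderiv 1)"
  define F G F' G' where "F = flat_exp 1 (1 * x + - s)" and "G = flat_exp 1 ((-1) * x + (s + \<epsilon>))"
    and "F' = flat_exp q (1 * x + - s)" and "G' = flat_exp q ((-1) * x + (s + \<epsilon>))"
  have q: "0 \<le> flat_exp q y" for y by (rule flat_exp_nonneg) (simp add: q_def)
  have nonneg: "0 \<le> F" "0 \<le> G" "0 \<le> F'" "0 \<le> G'"
    by (simp_all only: F_def G_def F'_def G'_def q flat_exp_1)
  have D: "0 < F + G" unfolding F_def G_def by (rule step_denom_pos)
  have "(smooth_step s \<epsilon> has_real_derivative
      F' * 1 * inverse (F + G) + - (inverse (F + G) * (F' * 1 + G' * (-1)) * inverse (F + G)) * F) (at x)"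
    unfolding smooth_step_def[abs_def] F_def G_def F'_def G'_def q_def
    by (intro DERIV_mult DERIV_inverse' DERIV_add flat_exp_affine_has_derivative)
       (use step_denom_pos[of x] in \<open>metis less_irrefl\<close>)
  then have "deriv (smooth_step s \<epsilon>) x =
      F' * 1 * inverse (F + G) + - (inverse (F + G) * (F' * 1 + G' * (-1)) * inverse (F + G)) * F"
    by (rule DERIV_imp_deriv)
  also have "\<dots> = (F' * G + F * G') / (F + G)\<^sup>2"
    using D by (simp add: divide_simps power2_eq_square) (simp add: algebra_simps)
  finally show ?thesis using nonneg by simp
qed

lemma deriv_smooth_step_outside: "x \<notin> {s..s + \<epsilon>} \<Longrightarrow> deriv (smooth_step s \<epsilon>) x = 0"
proof -
  assume x: "x \<notin> {s..s + \<epsilon>}"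
  show ?thesis
  proof (rule DERIV_imp_deriv, cases "x < s")
    case True
    show "(smooth_step s \<epsilon> has_real_derivative 0) (at x)"
      by (rule has_field_derivative_transform_within_open[of "\<lambda>_. 0" _ _ "{..<s}"])
         (use True in \<open>auto simp: smooth_step_left\<close>)
  next
    case False
    show "(smooth_step s \<epsilon> has_real_derivative 0) (at x)"
      by (rule has_field_derivative_transform_within_open[of "\<lambda>_. 1" _ _ "{s + \<epsilon><..}"])
         (use x False in \<open>auto simp: smooth_step_right\<close>)
  qed
qed

text \<open>The derivative of a step is nonnegative, has integral \<open>1\<close> and lives on \<open>{s..s + \<epsilon>}\<close>: integrating
  against it averages the values of \<open>w\<close> there.\<close>

lemma deriv_smooth_step_average:
  fixes w :: "real \<Rightarrow> complex"
  assumes se: "0 \<le> s" "s + \<epsilon> \<le> 1" and w: "continuous_on {0..1} w"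
    and \<delta>: "\<And>x. x \<in> {s..s + \<epsilon>} \<Longrightarrow> norm (w x - z) \<le> \<delta>"
  shows "norm (integral {0..1} (\<lambda>x. deriv (smooth_step s \<epsilon>) x *\<^sub>R w x) - z) \<le> \<delta>"
proof -
  let ?d = "deriv (smooth_step s \<epsilon>)"
  have dc: "continuous_on S ?d" for S by (intro smooth_continuous smooth_deriv smooth_smooth_step)
  have "(?d has_integral (smooth_step s \<epsilon> 1 - smooth_step s \<epsilon> 0)) {0..1}"
    by (rule fundamental_theorem_of_calculus)
       (auto simp flip: has_real_derivative_iff_has_vector_derivative
          intro!: has_field_derivative_at_within smooth_deriv smooth_smooth_step)
  then have d1: "(?d has_integral 1) {0..1}"
    using se by (simp add: smooth_step_left smooth_step_right)
  have "((\<lambda>x. ?d x *\<^sub>R z) has_integral 1 *\<^sub>R z) {0..1}"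
    using d1 by (rule has_integral_scaleR_left)
  then have "integral {0..1} (\<lambda>x. ?d x *\<^sub>R w x) - z = integral {0..1} (\<lambda>x. ?d x *\<^sub>R w x - ?d x *\<^sub>R z)"
    by (subst integral_diff) (auto simp: integral_unique
        intro!: integrable_continuous_interval continuous_intros dc w)
  also have "norm \<dots> \<le> integral {0..1} (\<lambda>x. ?d x * \<delta>)"
  proof (rule integral_norm_bound_integral)
    show "(\<lambda>x. ?d x *\<^sub>R w x - ?d x *\<^sub>R z) integrable_on {0..1}" "(\<lambda>x. ?d x * \<delta>) integrable_on {0..1}"
      by (intro integrable_continuous_interval continuous_intros dc w)+
    fix x
    show "norm (?d x *\<^sub>R w x - ?d x *\<^sub>R z) \<le> ?d x * \<delta>"
    proof (cases "x \<in> {s..s + \<epsilon>}")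
      case True
      then show ?thesis using \<delta> deriv_smooth_step_nonneg[of x]
        by (simp add: mult_left_mono flip: scaleR_diff_right)
    qed (simp add: deriv_smooth_step_outside)
  qed
  also have "\<dots> = \<delta>"
    using integral_unique[OF has_integral_mult_left[OF d1, of \<delta>]] by simp
  finally show ?thesis .
qed

end

section \<open>Weak derivatives on the unit interval\<close>

definition supported_inside :: "(real \<Rightarrow> real) \<Rightarrow> bool" where
  "supported_inside \<eta> \<longleftrightarrow> (\<exists>a b. 0 < a \<and> b < 1 \<and> (\<forall>t. t \<notin> {a..b} \<longrightarrow> \<eta> t = 0))"

text \<open>Only test functions from \<^const>\<open>smooth_fun\<close> are used. They contain the steps, they are closed under
  multiplication by exponentials, and each of them is a \<^const>\<open>test_function\<close>.\<close>

definition has_weak_derivative :: "(real \<Rightarrow> complex) \<Rightarrow> (real \<Rightarrow> complex) \<Rightarrow> bool" where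
  "has_weak_derivative w v \<longleftrightarrow> (\<forall>\<eta>. smooth_fun \<eta> \<longrightarrow> supported_inside \<eta> \<longrightarrow>
     (LINT t|lebesgue_on {0<..<1}. deriv \<eta> t *\<^sub>R w t) = - (LINT t|lebesgue_on {0<..<1}. \<eta> t *\<^sub>R v t))"

lemma lebesgue_integral_unit_interval:
  fixes f :: "real \<Rightarrow> 'a::euclidean_space"
  assumes "continuous_on {0..1} f"
  shows "(LINT t|lebesgue_on {0<..<1}. f t) = integral {0..1} f"
  using lebesgue_integral_eq_integral[OF integrable_lebesgue_on_open_interval[OF assms]]
  by (simp add: integral_open_interval_real)

lemma integrable_continuous_scaleR:
  fixes f :: "real \<Rightarrow> real" and v :: "real \<Rightarrow> complex"
  assumes f: "continuous_on {0..1} f" and v: "integrable (lebesgue_on {0<..<1}) v"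
  shows "integrable (lebesgue_on {0<..<1}) (\<lambda>t. f t *\<^sub>R v t)"
proof -
  have "bounded (f ` {0..1})" by (intro compact_imp_bounded compact_continuous_image f) auto
  then obtain B where B: "\<And>x. x \<in> {0..1} \<Longrightarrow> \<bar>f x\<bar> \<le> B"
    by (metis bounded_iff imageI real_norm_def)
  show ?thesis
  proof (rule Bochner_Integration.integrable_bound)
    show "integrable (lebesgue_on {0<..<1}) (\<lambda>t. B *\<^sub>R v t)" using v by simp
    show "(\<lambda>t. f t *\<^sub>R v t) \<in> borel_measurable (lebesgue_on {0<..<1})"
      using borel_measurable_integrable[OF integrable_lebesgue_on_open_interval[OF f]]
        borel_measurable_integrable[OF v] by measurable
    show "AE t in lebesgue_on {0<..<1}. norm (f t *\<^sub>R v t) \<le> norm (B *\<^sub>R v t)"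
    proof (rule AE_I2)
      fix t :: real assume "t \<in> space (lebesgue_on {0<..<1})"
      then have "\<bar>f t\<bar> \<le> \<bar>B\<bar>" using B[of t] by (auto simp: space_restrict_space)
      then show "norm (f t *\<^sub>R v t) \<le> norm (B *\<^sub>R v t)"
        by (simp add: mult_right_mono)
    qed
  qed
qed

text \<open>Test with a step up just after \<open>0\<close> minus a step up just after \<open>t\<close>. As the width of the steps tends to
  \<open>0\<close>, the test function converges to the indicator of \<open>(0, t]\<close>, while its derivative
  averages \<open>w\<close> near \<open>0\<close> and, with a minus sign, near \<open>t\<close>.\<close>

lemma weak_derivative_imp_integral:
  assumes w: "continuous_on {0..1} w" and v: "integrable (lebesgue_on {0<..<1}) v"
    and weak: "has_weak_derivative w v" and t: "0 < t" "t < 1"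
  shows "w t - w 0 = (LINT s|lebesgue_on {0<..<1}. indicator {0..t} s *\<^sub>R v s)"
proof -
  \<comment> \<open>Narrow compared with both \<open>t\<close> and \<open>1 - t\<close>: the two steps do not overlap and stay inside the interval.\<close>
  define e where "e k = t * (1 - t) / (real k + 3)" for k
  have e0: "0 < e k" for k using t by (simp add: e_def)
  have et: "3 * e k \<le> t" "t + e k < 1" "2 * e k < 1" for k
  proof -
    define q where "q = t * (1 - t)"
    have "t * (1 - t) \<le> t * 1" "t * (1 - t) \<le> 1 * (1 - t)" "0 \<le> t * (1 - t)"
      using t by (intro mult_left_mono mult_right_mono mult_nonneg_nonneg; simp)+
    then have q: "q \<le> t" "q \<le> 1 - t" "0 \<le> q"
      by (simp_all only: q_def mult_1_left mult_1_right)
    then have "3 * q \<le> q * (real k + 3)" by (simp add: algebra_simps)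
    then have "3 * e k \<le> q" unfolding e_def q_def[symmetric] by (simp add: divide_le_eq)
    then show "3 * e k \<le> t" "t + e k < 1" "2 * e k < 1"
      using e0[of k] t q by linarith+
  qed
  have elim: "e \<longlonglongrightarrow> 0"
    unfolding e_def[abs_def] by real_asymp
  define \<eta> where "\<eta> k x = smooth_step (e k) (e k) x + (-1) * smooth_step t (e k) x" for k x
  have \<eta>s: "smooth_fun (\<eta> k)" for k
    unfolding \<eta>_def[abs_def] by (intro smooth_fun.intros smooth_const smooth_smooth_step e0)
  have d\<eta>: "deriv (\<eta> k) x = deriv (smooth_step (e k) (e k)) x - deriv (smooth_step t (e k)) x" for k x
    unfolding \<eta>_def[abs_def]
    by (rule DERIV_imp_deriv) (auto intro!: derivative_eq_intros smooth_deriv smooth_smooth_step e0)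
  have \<eta>b: "\<bar>\<eta> k x\<bar> \<le> 1" for k x
    using smooth_step_bounds[OF e0[of k], of "e k" x] smooth_step_bounds[OF e0[of k], of t x]
    by (simp add: \<eta>_def abs_le_iff)
  have supp: "supported_inside (\<eta> k)" for k
    unfolding supported_inside_def
  proof (intro exI conjI allI impI)
    show "0 < e k" "t + e k < 1" using e0 et by auto
    fix x assume "x \<notin> {e k..t + e k}"
    then show "\<eta> k x = 0"
      using et[of k] e0[of k] by (auto simp: \<eta>_def smooth_step_left smooth_step_right not_le)
  qed
  have dc: "continuous_on S (deriv (smooth_step s (e k)))" for S s k
    by (intro smooth_continuous smooth_deriv smooth_smooth_step e0)
  have step: "(\<lambda>k. integral {0..1} (\<lambda>x. deriv (smooth_step (s k) (e k)) x *\<^sub>R w x)) \<longlonglongrightarrow> w r"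
    if s: "s \<longlonglongrightarrow> r" "\<And>k. r \<le> s k" "\<And>k. s k + e k \<le> 1" and r: "0 \<le> r" for s r
  proof (rule LIMSEQ_I)
    fix \<delta> :: real assume \<delta>: "0 < \<delta>"
    have "r \<le> 1" using s(2,3)[of 0] e0[of 0] by linarith
    then obtain d where d: "0 < d" "\<And>x. x \<in> {0..1} \<Longrightarrow> dist x r < d \<Longrightarrow> dist (w x) (w r) < \<delta> / 2"
      using w r \<delta> unfolding continuous_on_iff by (metis atLeastAtMost_iff half_gt_zero)
    have "(\<lambda>k. s k + e k - r) \<longlonglongrightarrow> r + 0 - r" by (intro tendsto_intros s elim)
    then have "\<forall>\<^sub>F k in sequentially. s k + e k - r < d"
      using d(1) by (intro order_tendstoD(2)) auto
    then obtain k0 where k0: "\<And>k. k \<ge> k0 \<Longrightarrow> s k + e k - r < d"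
      by (auto simp: eventually_sequentially)
    have "norm (integral {0..1} (\<lambda>x. deriv (smooth_step (s k) (e k)) x *\<^sub>R w x) - w r) < \<delta>" if "k \<ge> k0" for k
    proof -
      have "norm (integral {0..1} (\<lambda>x. deriv (smooth_step (s k) (e k)) x *\<^sub>R w x) - w r) \<le> \<delta> / 2"
      proof (rule deriv_smooth_step_average[OF e0 _ s(3) w])
        show "0 \<le> s k" using s(2)[of k] r by linarith
        fix x assume x: "x \<in> {s k..s k + e k}"
        then have "x \<in> {0..1}" "dist x r < d"
          using s(2,3)[of k] r k0[OF that] by (auto simp: dist_real_def)
        then show "norm (w x - w r) \<le> \<delta> / 2" using d(2) by (fastforce simp: dist_norm)
      qed
      then show ?thesis using \<delta> by linarith
    qed
    then show "\<exists>k0. \<forall>k\<ge>k0. norm (integral {0..1} (\<lambda>x. deriv (smooth_step (s k) (e k)) x *\<^sub>R w x) - w r) < \<delta>"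
      by blast
  qed
  have lhs: "(LINT x|lebesgue_on {0<..<1}. deriv (\<eta> k) x *\<^sub>R w x) =
      integral {0..1} (\<lambda>x. deriv (smooth_step (e k) (e k)) x *\<^sub>R w x) - integral {0..1} (\<lambda>x. deriv (smooth_step t (e k)) x *\<^sub>R w x)" for k
  proof -
    have "(LINT x|lebesgue_on {0<..<1}. deriv (\<eta> k) x *\<^sub>R w x) = integral {0..1} (\<lambda>x. deriv (\<eta> k) x *\<^sub>R w x)"
      by (intro lebesgue_integral_unit_interval continuous_intros smooth_continuous smooth_deriv \<eta>s w)
    also have "\<dots> = integral {0..1} (\<lambda>x. deriv (smooth_step (e k) (e k)) x *\<^sub>R w x - deriv (smooth_step t (e k)) x *\<^sub>R w x)"
      by (simp add: d\<eta> scaleR_diff_left)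
    also have "\<dots> = integral {0..1} (\<lambda>x. deriv (smooth_step (e k) (e k)) x *\<^sub>R w x) - integral {0..1} (\<lambda>x. deriv (smooth_step t (e k)) x *\<^sub>R w x)"
      by (intro integral_diff integrable_continuous_interval continuous_intros dc w)
    finally show ?thesis .
  qed
  have L: "(\<lambda>k. LINT x|lebesgue_on {0<..<1}. deriv (\<eta> k) x *\<^sub>R w x) \<longlonglongrightarrow> w 0 - w t"
    unfolding lhs
  proof (intro tendsto_diff step elim tendsto_const)
    show "0 \<le> e k" "e k + e k \<le> 1" "t + e k \<le> 1" for k
      using e0[of k] et[of k] by linarith+
  qed (use t in auto)
  have R: "(\<lambda>k. LINT x|lebesgue_on {0<..<1}. \<eta> k x *\<^sub>R v x) \<longlonglongrightarrow> (LINT s|lebesgue_on {0<..<1}. indicator {0..t} s *\<^sub>R v s)"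
  proof (rule integral_dominated_convergence[where w = "\<lambda>x. norm (v x)"])
    have m: "v \<in> borel_measurable (lebesgue_on {0<..<1})" using v by (rule borel_measurable_integrable)
    show "(\<lambda>s. indicator {0..t} s *\<^sub>R v s) \<in> borel_measurable (lebesgue_on {0<..<1})"
      by (intro borel_measurable_scaleR m measurable_restrict_space1 borel_measurable_indicator) simp
    show "(\<lambda>x. \<eta> k x *\<^sub>R v x) \<in> borel_measurable (lebesgue_on {0<..<1})" for k
      by (intro borel_measurable_integrable integrable_continuous_scaleR smooth_continuous \<eta>s v)
    show "integrable (lebesgue_on {0<..<1}) (\<lambda>x. norm (v x))" using v by simp
    show "AE x in lebesgue_on {0<..<1}. norm (\<eta> k x *\<^sub>R v x) \<le> norm (v x)" for k
      by (rule AE_I2) (simp add: mult_left_le_one_le \<eta>b)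
    show "AE x in lebesgue_on {0<..<1}. (\<lambda>k. \<eta> k x *\<^sub>R v x) \<longlonglongrightarrow> indicator {0..t} x *\<^sub>R v x"
    proof (rule AE_I2)
      fix x :: real assume "x \<in> space (lebesgue_on {0<..<1})"
      then have x: "0 < x" "x < 1" by (auto simp: space_restrict_space)
      have "(\<lambda>k. e k + e k) \<longlonglongrightarrow> 0 + 0" by (intro tendsto_intros elim)
      then have 1: "\<forall>\<^sub>F k in sequentially. e k + e k < x"
        using x by (intro order_tendstoD(2)) auto
      have "\<forall>\<^sub>F k in sequentially. \<eta> k x = indicator {0..t} x"
      proof (cases "x \<le> t")
        case True
        show ?thesis using 1
          by eventually_elim (use True x e0 in \<open>auto simp: \<eta>_def smooth_step_left smooth_step_right\<close>)
      next
        case False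
        have "(\<lambda>k. t + e k) \<longlonglongrightarrow> t + 0" by (intro tendsto_intros elim)
        then have "\<forall>\<^sub>F k in sequentially. t + e k < x"
          using False by (intro order_tendstoD(2)) auto
        with 1 show ?thesis
          by eventually_elim (use False x e0 in \<open>auto simp: \<eta>_def smooth_step_left smooth_step_right\<close>)
      qed
      then have "(\<lambda>k. \<eta> k x) \<longlonglongrightarrow> indicator {0..t} x" by (rule tendsto_eventually)
      then show "(\<lambda>k. \<eta> k x *\<^sub>R v x) \<longlonglongrightarrow> indicator {0..t} x *\<^sub>R v x"
        by (intro tendsto_intros)
    qed
  qed
  have "(LINT x|lebesgue_on {0<..<1}. deriv (\<eta> k) x *\<^sub>R w x) = - (LINT x|lebesgue_on {0<..<1}. \<eta> k x *\<^sub>R v x)" for k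
    using weak \<eta>s supp unfolding has_weak_derivative_def by blast
  then have "(\<lambda>k. LINT x|lebesgue_on {0<..<1}. deriv (\<eta> k) x *\<^sub>R w x) \<longlonglongrightarrow> - (LINT s|lebesgue_on {0<..<1}. indicator {0..t} s *\<^sub>R v s)"
    using tendsto_minus[OF R] by simp
  from LIMSEQ_unique[OF L this] show ?thesis by (simp add: algebra_simps)
qed

text \<open>The product rule for an integrating factor: move the exponential into the test function.\<close>

lemma has_weak_derivative_exp_mult:
  assumes w: "continuous_on {0..1} w" and v: "integrable (lebesgue_on {0<..<1}) v"
    and weak: "has_weak_derivative w v"
  shows "has_weak_derivative (\<lambda>t. exp (c * t) *\<^sub>R w t) (\<lambda>t. exp (c * t) *\<^sub>R (v t + c *\<^sub>R w t))"
  unfolding has_weak_derivative_def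
proof (intro allI impI)
  fix \<eta> assume s: "smooth_fun \<eta>" and i: "supported_inside \<eta>"
  \<comment> \<open>The factor \<open>1\<close> gives the exponential the shape required by \<^const>\<open>smooth_fun\<close>.\<close>
  define \<theta> where "\<theta> x = \<eta> x * (1 * exp (c * x))" for x
  have s': "smooth_fun \<theta>" unfolding \<theta>_def[abs_def] by (intro smooth_fun.intros s)
  have i': "supported_inside \<theta>" using i unfolding supported_inside_def \<theta>_def by fastforce
  have d: "deriv \<theta> t = deriv \<eta> t * exp (c * t) + \<eta> t * (exp (c * t) * c)" for t
    unfolding \<theta>_def[abs_def]
    by (rule DERIV_imp_deriv) (auto intro!: derivative_eq_intros smooth_deriv s)
  have iw: "integrable (lebesgue_on {0<..<1}) w" by (rule integrable_lebesgue_on_open_interval[OF w])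
  have I1: "integrable (lebesgue_on {0<..<1}) (\<lambda>t. (deriv \<eta> t * exp (c * t)) *\<^sub>R w t)"
    by (intro integrable_continuous_scaleR iw continuous_intros smooth_continuous smooth_deriv s)
  have I2: "integrable (lebesgue_on {0<..<1}) (\<lambda>t. (\<eta> t * (exp (c * t) * c)) *\<^sub>R w t)"
    by (intro integrable_continuous_scaleR iw continuous_intros smooth_continuous s)
  have I3: "integrable (lebesgue_on {0<..<1}) (\<lambda>t. (\<eta> t * exp (c * t)) *\<^sub>R v t)"
    by (intro integrable_continuous_scaleR v continuous_intros smooth_continuous s)
  have "(LINT t|lebesgue_on {0<..<1}. deriv \<theta> t *\<^sub>R w t) = - (LINT t|lebesgue_on {0<..<1}. \<theta> t *\<^sub>R v t)"
    using weak s' i' unfolding has_weak_derivative_def by blast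
  moreover have "(LINT t|lebesgue_on {0<..<1}. deriv \<theta> t *\<^sub>R w t) =
     (LINT t|lebesgue_on {0<..<1}. (deriv \<eta> t * exp (c * t)) *\<^sub>R w t)
      + (LINT t|lebesgue_on {0<..<1}. (\<eta> t * (exp (c * t) * c)) *\<^sub>R w t)"
    unfolding d scaleR_add_left by (rule Bochner_Integration.integral_add[OF I1 I2])
  moreover have "(LINT t|lebesgue_on {0<..<1}. \<eta> t *\<^sub>R (exp (c * t) *\<^sub>R (v t + c *\<^sub>R w t))) =
    (LINT t|lebesgue_on {0<..<1}. (\<eta> t * exp (c * t)) *\<^sub>R v t) +
     (LINT t|lebesgue_on {0<..<1}. (\<eta> t * (exp (c * t) * c)) *\<^sub>R w t)"
    by (subst Bochner_Integration.integral_add[OF I3 I2, symmetric])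
       (simp add: scaleR_add_right mult_ac)
  ultimately show "(LINT t|lebesgue_on {0<..<1}. deriv \<eta> t *\<^sub>R exp (c * t) *\<^sub>R w t) =
       - (LINT t|lebesgue_on {0<..<1}. \<eta> t *\<^sub>R exp (c * t) *\<^sub>R (v t + c *\<^sub>R w t))"
    by (simp add: \<theta>_def algebra_simps)
qed

text \<open>Multiplication by \<open>exp (- c t)\<close> turns \<open>w' = c w + g\<close> into an equation that is integrated directly; both
  this factor and its inverse are at most \<open>exp \<bar>c\<bar>\<close> on the unit interval.\<close>

lemma duhamel_estimate:
  assumes w: "continuous_on {0..1} w" and v: "integrable (lebesgue_on {0<..<1}) v"
    and weak: "has_weak_derivative w v" and t: "0 < t" "t < 1"
  shows "cmod (w t - of_real (exp (c * t)) * w 0) \<le>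
     exp (2 * \<bar>c\<bar>) * (LINT s|lebesgue_on {0<..<1}. cmod (v s - of_real c * w s))"
proof -
  let ?M = "lebesgue_on {0<..<1 :: real}"
  let ?g = "\<lambda>s. v s - of_real c * w s"
  have iw: "integrable ?M w" by (rule integrable_lebesgue_on_open_interval[OF w])
  have ig: "integrable ?M ?g" using v iw by auto
  have i2: "integrable ?M (\<lambda>s. exp (- c * s) *\<^sub>R ?g s)"
    by (intro integrable_continuous_scaleR ig continuous_intros)
  have e: "exp (a * s) \<le> exp \<bar>c\<bar>" if "\<bar>a\<bar> = \<bar>c\<bar>" "0 \<le> s" "s \<le> 1" for a s :: real
  proof -
    have "a * s \<le> \<bar>a\<bar> * s" using that by (intro mult_right_mono) auto
    also have "\<dots> \<le> \<bar>a\<bar> * 1" using that by (intro mult_left_mono) auto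
    finally show ?thesis using that by simp
  qed
  have "exp (- c * t) *\<^sub>R w t - exp (- c * 0) *\<^sub>R w 0 =
     (LINT s|?M. indicator {0..t} s *\<^sub>R (exp (- c * s) *\<^sub>R (v s + (- c) *\<^sub>R w s)))"
  proof (rule weak_derivative_imp_integral[OF _ _ has_weak_derivative_exp_mult[OF w v weak] t])
    show "continuous_on {0..1} (\<lambda>t. exp (- c * t) *\<^sub>R w t)" by (intro continuous_intros w)
    show "integrable ?M (\<lambda>t. exp (- c * t) *\<^sub>R (v t + (- c) *\<^sub>R w t))"
      using i2 by (simp add: scaleR_conv_of_real)
  qed
  then have eq: "exp (- c * t) *\<^sub>R w t - w 0 = (LINT s|?M. indicator {0..t} s *\<^sub>R (exp (- c * s) *\<^sub>R ?g s))"
    by (simp add: scaleR_conv_of_real)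
  have "cmod (exp (- c * t) *\<^sub>R w t - w 0) \<le> (LINT s|?M. cmod (indicator {0..t} s *\<^sub>R (exp (- c * s) *\<^sub>R ?g s)))"
    unfolding eq by (rule integral_norm_bound)
  also have "\<dots> \<le> (LINT s|?M. exp \<bar>c\<bar> * cmod (?g s))"
  proof (rule integral_mono')
    show "integrable ?M (\<lambda>s. exp \<bar>c\<bar> * cmod (?g s))" using ig by auto
    fix s :: real assume "s \<in> space ?M"
    then have "exp (- c * s) \<le> exp \<bar>c\<bar>" by (intro e) (auto simp: space_restrict_space)
    then show "cmod (indicator {0..t} s *\<^sub>R (exp (- c * s) *\<^sub>R ?g s)) \<le> exp \<bar>c\<bar> * cmod (?g s)"
      by (auto simp: indicator_def intro!: mult_right_mono)
  qed auto
  also have "\<dots> = exp \<bar>c\<bar> * (LINT s|?M. cmod (?g s))" by simp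
  finally have b: "cmod (exp (- c * t) *\<^sub>R w t - w 0) \<le> exp \<bar>c\<bar> * (LINT s|?M. cmod (?g s))" .
  have "w t - of_real (exp (c * t)) * w 0 = exp (c * t) *\<^sub>R (exp (- c * t) *\<^sub>R w t - w 0)"
    by (simp add: scaleR_diff_right flip: exp_add) (simp add: scaleR_conv_of_real)
  then have "cmod (w t - of_real (exp (c * t)) * w 0) = exp (c * t) * cmod (exp (- c * t) *\<^sub>R w t - w 0)"
    by simp
  also have "\<dots> \<le> exp \<bar>c\<bar> * (exp \<bar>c\<bar> * (LINT s|?M. cmod (?g s)))"
    using t by (intro mult_mono b e) auto
  also have "\<dots> = exp (2 * \<bar>c\<bar>) * (LINT s|?M. cmod (?g s))"
    by (simp add: mult.assoc[symmetric] flip: exp_add)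
  finally show ?thesis .
qed

lemma test_function_if_smooth:
  "smooth_fun \<eta> \<Longrightarrow> supported_inside \<eta> \<Longrightarrow> test_function \<eta>"
  unfolding test_function_def supported_inside_def field_differentiable_def
  using smooth_deriv(2)[OF smooth_iterated_deriv] by blast

lemma weak_deriv_coeff:
  assumes "weak_deriv N u v" "n \<le> N"
  shows "has_weak_derivative (\<lambda>t. innerH (u t) (Phi n)) (\<lambda>t. innerH (v t) (Phi n))"
  unfolding has_weak_derivative_def
proof (intro allI impI)
  fix \<eta> assume "smooth_fun \<eta>" "supported_inside \<eta>"
  then have "test_function \<eta>" by (rule test_function_if_smooth)
  then show "(LINT t|lebesgue_on {0<..<1}. deriv \<eta> t *\<^sub>R innerH (u t) (Phi n))
        = - (LINT t|lebesgue_on {0<..<1}. \<eta> t *\<^sub>R innerH (v t) (Phi n))"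
    using assms(1) Phi_in_HN[OF assms(2)] unfolding weak_deriv_def by blast
qed

lemma has_weak_derivative_add_scaled:
  assumes w: "continuous_on {0..1} w1" "continuous_on {0..1} w2"
    and v: "integrable (lebesgue_on {0<..<1}) v1" "integrable (lebesgue_on {0<..<1}) v2"
    and weak: "has_weak_derivative w1 v1" "has_weak_derivative w2 v2"
  shows "has_weak_derivative (\<lambda>t. w1 t + c *\<^sub>R w2 t) (\<lambda>t. v1 t + c *\<^sub>R v2 t)"
  unfolding has_weak_derivative_def
proof (intro allI impI)
  fix \<eta> assume s: "smooth_fun \<eta>" and i: "supported_inside \<eta>"
  have I: "integrable (lebesgue_on {0<..<1}) (\<lambda>t. deriv \<eta> t *\<^sub>R w1 t)"
     "integrable (lebesgue_on {0<..<1}) (\<lambda>t. c *\<^sub>R (deriv \<eta> t *\<^sub>R w2 t))"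
     "integrable (lebesgue_on {0<..<1}) (\<lambda>t. \<eta> t *\<^sub>R v1 t)"
     "integrable (lebesgue_on {0<..<1}) (\<lambda>t. c *\<^sub>R (\<eta> t *\<^sub>R v2 t))"
    by (intro integrable_scaleR_right integrable_continuous_scaleR v integrable_lebesgue_on_open_interval w
        smooth_continuous smooth_deriv s)+
  have e: "(LINT t|lebesgue_on {0<..<1}. deriv \<eta> t *\<^sub>R w1 t) = - (LINT t|lebesgue_on {0<..<1}. \<eta> t *\<^sub>R v1 t)"
     "(LINT t|lebesgue_on {0<..<1}. deriv \<eta> t *\<^sub>R w2 t) = - (LINT t|lebesgue_on {0<..<1}. \<eta> t *\<^sub>R v2 t)"
    using weak s i unfolding has_weak_derivative_def by blast+
  have "(LINT t|lebesgue_on {0<..<1}. deriv \<eta> t *\<^sub>R (w1 t + c *\<^sub>R w2 t)) =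
      (LINT t|lebesgue_on {0<..<1}. deriv \<eta> t *\<^sub>R w1 t + c *\<^sub>R (deriv \<eta> t *\<^sub>R w2 t))"
    by (simp add: scaleR_add_right mult.commute)
  also have "\<dots> = - ((LINT t|lebesgue_on {0<..<1}. \<eta> t *\<^sub>R v1 t) + (LINT t|lebesgue_on {0<..<1}. c *\<^sub>R (\<eta> t *\<^sub>R v2 t)))"
    unfolding Bochner_Integration.integral_add[OF I(1,2)] integral_scaleR_right e by simp
  also have "\<dots> = - (LINT t|lebesgue_on {0<..<1}. \<eta> t *\<^sub>R v1 t + c *\<^sub>R (\<eta> t *\<^sub>R v2 t))"
    unfolding Bochner_Integration.integral_add[OF I(3,4)] ..
  also have "\<dots> = - (LINT t|lebesgue_on {0<..<1}. \<eta> t *\<^sub>R (v1 t + c *\<^sub>R v2 t))"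
    by (simp add: scaleR_add_right mult.commute)
  finally show "(LINT t|lebesgue_on {0<..<1}. deriv \<eta> t *\<^sub>R (w1 t + c *\<^sub>R w2 t)) =
    - (LINT t|lebesgue_on {0<..<1}. \<eta> t *\<^sub>R (v1 t + c *\<^sub>R v2 t))" .
qed

text \<open>The variance of \<open>Y\<close> on the unit interval is nonnegative.\<close>

lemma integral_square_le:
  assumes Y: "continuous_on {0..1} (Y :: real \<Rightarrow> real)"
  shows "(integral {0..1} Y)\<^sup>2 \<le> integral {0..1} (\<lambda>t. (Y t)\<^sup>2)"
proof -
  define c where "c = integral {0..1} Y"
  have i: "(\<lambda>t. (Y t)\<^sup>2) integrable_on {0..1}" "(\<lambda>t. 2 * c * Y t) integrable_on {0..1}" "(\<lambda>t. c\<^sup>2) integrable_on {0..1 :: real}"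
    by (intro integrable_continuous_interval continuous_intros Y)+
  have "0 \<le> integral {0..1} (\<lambda>t. (Y t - c)\<^sup>2)"
    by (intro integral_nonneg integrable_continuous_interval continuous_intros Y) auto
  also have "\<dots> = integral {0..1} (\<lambda>t. ((Y t)\<^sup>2 - 2 * c * Y t) + c\<^sup>2)"
    by (simp add: power2_diff algebra_simps)
  also have "\<dots> = integral {0..1} (\<lambda>t. (Y t)\<^sup>2) - 2 * c * c + c\<^sup>2"
    using i by (simp add: integral_add integral_diff integrable_diff c_def)
  finally show ?thesis by (simp add: c_def power2_eq_square)
qed

section \<open>Observability of the modal system\<close>

lemma sum_pairs: "(\<Sum>m\<le>2 * N + 1. f m) = (\<Sum>n\<le>N. f (2 * n) + f (2 * n + 1 :: nat) :: 'a::comm_monoid_add)"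
  by (induction N) (simp_all add: add_ac)

lemma freq_even: "freq (2 * n) = 2 * real n" and freq_odd: "freq (2 * n + 1) = - (2 * real n + 1)"
  by (simp_all add: freq_def)

lemma freq_root: "freq m * (freq m + 1) = 2 * real (m div 2) * (2 * real (m div 2) + 1)"
proof (cases "even m")
  case True
  then obtain n where "m = 2 * n" by (elim evenE)
  then show ?thesis by (simp add: freq_even)
next
  case False
  then obtain n where m: "m = 2 * n + 1" by (elim oddE)
  then show ?thesis unfolding m freq_odd by (simp add: algebra_simps)
qed

lemma abs_freq_shift: "1 \<le> \<bar>2 * freq m + 1\<bar>" "\<bar>2 * freq m + 1\<bar> \<le> 2 * real m + 1"
proof -
  show "1 \<le> \<bar>2 * freq m + 1\<bar>"
    by (cases "even m") (auto simp: freq_def elim: oddE)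
  show "\<bar>2 * freq m + 1\<bar> \<le> 2 * real m + 1"
    using abs_triangle_ineq[of "2 * freq m" 1] by (simp add: abs_mult)
qed

lemma le_exp_self:
  assumes "1 \<le> (E :: real)" shows "E \<le> exp E" "2 \<le> exp E"
  using exp_ge_add_one_self[of E] assms by linarith+

text \<open>The scalar form of the problem: \<open>a\<close>, \<open>p\<close>, \<open>r\<close> are the coefficients of the solution and of its first and
  second time derivatives, and \<open>Y\<close> is the norm of the observation. The Boolean \<open>b\<close> in the observation
  hypothesis selects the even or the odd modes.\<close>

locale modal_system =
  fixes N :: nat and \<mu> :: real and a p r :: "nat \<Rightarrow> real \<Rightarrow> complex" and Y :: "real \<Rightarrow> real"
  assumes mu: "0 \<le> \<mu>" "\<mu> \<le> real N + 1"
    and ca: "\<And>n. n \<le> N \<Longrightarrow> continuous_on {0..1} (a n)"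
    and cp: "\<And>n. n \<le> N \<Longrightarrow> continuous_on {0..1} (p n)"
    and ir: "\<And>n. n \<le> N \<Longrightarrow> integrable (lebesgue_on {0<..<1}) (r n)"
    and wa: "\<And>n. n \<le> N \<Longrightarrow> has_weak_derivative (a n) (p n)"
    and wp: "\<And>n. n \<le> N \<Longrightarrow> has_weak_derivative (p n) (r n)"
    and cY: "continuous_on {0..1} Y"
    and obs: "\<And>b t. t \<in> {0..1} \<Longrightarrow>
        cmod (\<Sum>n\<le>N. of_real (if even n = b then endval n else 0) * a n t) \<le> Y t"
    and forcing: "\<And>n. n \<le> N \<Longrightarrow> AE t in lebesgue_on {0<..<1}.
        cmod (r n t + p n t - of_real (2 * real n * (2 * real n + 1)) * a n t) \<le> 2 * \<mu> * \<bar>endval n\<bar> * Y t"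
begin

definition amp :: "nat \<Rightarrow> real \<Rightarrow> complex" where
  "amp m t = p (m div 2) t + (1 + freq m) *\<^sub>R a (m div 2) t"

text \<open>All losses are collected as powers of \<open>exp E\<close>. As \<open>E \<ge> 1\<close>, factors such as \<open>2\<close>, \<open>N\<close> or \<open>\<mu>\<close> are
  absorbed by raising the exponent.\<close>

abbreviation "I1 \<equiv> integral {0..1} Y"
abbreviation "E \<equiv> real N + 1"

lemma Y_nonneg: "t \<in> {0..1} \<Longrightarrow> 0 \<le> Y t"
  using obs[of t True] norm_ge_zero order_trans by blast

lemma I1_nonneg: "0 \<le> I1"
  using Y_nonneg by (intro integral_nonneg integrable_continuous_interval cY)

lemma amp_estimate:
  assumes m: "m \<le> 2 * N + 1" and t: "0 < t" "t < 1"
  shows "cmod (amp m t - of_real (exp (freq m * t)) * amp m 0) \<le> exp (2 * real m) * (2 * \<mu> * \<bar>endval (m div 2)\<bar> * I1)"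
proof -
  let ?M = "lebesgue_on {0<..<1 :: real}"
  define n where "n = m div 2"
  have n: "n \<le> N" using m by (simp add: n_def)
  have ip: "integrable ?M (p n)" "integrable ?M (a n)"
    by (intro integrable_lebesgue_on_open_interval cp ca n)+
  have zc: "continuous_on {0..1} (amp m)"
    unfolding amp_def[abs_def] n_def[symmetric] by (intro continuous_intros cp ca n)
  have iv: "integrable ?M (\<lambda>t. r n t + (1 + freq m) *\<^sub>R p n t)"
    using ir[OF n] ip by auto
  have "has_weak_derivative (amp m) (\<lambda>t. r n t + (1 + freq m) *\<^sub>R p n t)"
    unfolding amp_def[abs_def] n_def[symmetric]
    by (intro has_weak_derivative_add_scaled cp ca ir ip wa wp n)
  from duhamel_estimate[OF zc iv this t, of "freq m"]
  have "cmod (amp m t - of_real (exp (freq m * t)) * amp m 0) \<le>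
      exp (2 * real m) * (LINT s|?M. cmod (r n s + (1 + freq m) *\<^sub>R p n s - of_real (freq m) * amp m s))"
    by simp
  also have "(\<lambda>s. r n s + (1 + freq m) *\<^sub>R p n s - of_real (freq m) * amp m s) =
      (\<lambda>s. r n s + p n s - of_real (2 * real n * (2 * real n + 1)) * a n s)"
    unfolding amp_def n_def[symmetric] freq_root[of m, folded n_def, symmetric]
    by (simp add: fun_eq_iff scaleR_conv_of_real algebra_simps)
  also have "(LINT s|?M. cmod (r n s + p n s - of_real (2 * real n * (2 * real n + 1)) * a n s))
     \<le> (LINT s|?M. 2 * \<mu> * \<bar>endval n\<bar> * Y s)"
  proof (rule integral_mono_AE[OF _ _ forcing[OF n]])
    show "integrable ?M (\<lambda>s. cmod (r n s + p n s - of_real (2 * real n * (2 * real n + 1)) * a n s))"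
      using ir[OF n] ip by auto
    show "integrable ?M (\<lambda>s. 2 * \<mu> * \<bar>endval n\<bar> * Y s)"
      by (intro integrable_lebesgue_on_open_interval continuous_intros cY)
  qed
  also have "\<dots> = 2 * \<mu> * \<bar>endval n\<bar> * I1"
    by (subst lebesgue_integral_unit_interval) (auto intro!: continuous_intros cY)
  finally show ?thesis by (simp add: n_def)
qed

text \<open>Since \<open>2 freq m + 1\<close> is \<open>4n + 1\<close> or \<open>-(4n + 1)\<close>, this is the identity
  \<open>a n = (amp (2n) - amp (2n+1)) / (4n + 1)\<close> summed over the modes.\<close>

lemma amp_recombine:
  "(\<Sum>m\<le>2 * N + 1. of_real (\<beta> (m div 2) / (2 * freq m + 1)) * amp m t) = (\<Sum>n\<le>N. of_real (\<beta> n) * a n t)"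
  unfolding sum_pairs
proof (rule sum.cong[OF refl])
  fix n :: nat
  have d: "2 * n div 2 = n" "(2 * n + 1) div 2 = n" by auto
  have "4 * complex_of_real (real n) + 1 = complex_of_real (4 * real n + 1)" by simp
  moreover have "4 * real n + 1 \<noteq> 0" using of_nat_0_le_iff[of n] by linarith
  ultimately have ne: "4 * complex_of_real (real n) + 1 \<noteq> 0"
    by (simp only: of_real_eq_0_iff not_False_eq_True)
  have e: "complex_of_real (\<beta> n / (2 * freq (2 * n) + 1)) = of_real (\<beta> n) / (4 * of_real (real n) + 1)"
    "complex_of_real (\<beta> n / (2 * freq (2 * n + 1) + 1)) = - (of_real (\<beta> n) / (4 * of_real (real n) + 1))"
  proof -
    have "\<beta> n / (2 * freq (2 * n) + 1) = \<beta> n / (4 * real n + 1)" by (simp add: freq_even)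
    then show "complex_of_real (\<beta> n / (2 * freq (2 * n) + 1)) = of_real (\<beta> n) / (4 * of_real (real n) + 1)"
      by (simp only:) simp
    have "2 * freq (2 * n + 1) + 1 = - (4 * real n + 1)" unfolding freq_odd by simp
    then have "\<beta> n / (2 * freq (2 * n + 1) + 1) = - (\<beta> n / (4 * real n + 1))"
      by (simp only: minus_divide_right)
    then show "complex_of_real (\<beta> n / (2 * freq (2 * n + 1) + 1)) = - (of_real (\<beta> n) / (4 * of_real (real n) + 1))"
      by (simp only:) simp
  qed
  have zz: "amp (2 * n) t - amp (2 * n + 1) t = (4 * of_real (real n) + 1) * a n t"
    unfolding amp_def d freq_even freq_odd by (simp add: scaleR_conv_of_real algebra_simps)
  have "of_real (\<beta> (2 * n div 2) / (2 * freq (2 * n) + 1)) * amp (2 * n) t +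
      of_real (\<beta> ((2 * n + 1) div 2) / (2 * freq (2 * n + 1) + 1)) * amp (2 * n + 1) t =
      of_real (\<beta> n) / (4 * of_real (real n) + 1) * (amp (2 * n) t - amp (2 * n + 1) t)"
    unfolding d e by (simp add: algebra_simps)
  also have "\<dots> = of_real (\<beta> n) * a n t"
    unfolding zz using ne by simp
  finally show "of_real (\<beta> (2 * n div 2) / (2 * freq (2 * n) + 1)) * amp (2 * n) t +
      of_real (\<beta> ((2 * n + 1) div 2) / (2 * freq (2 * n + 1) + 1)) * amp (2 * n + 1) t = of_real (\<beta> n) * a n t" .
qed

text \<open>The free evolution of the amplitudes produces the observed signal up to the Duhamel errors. Each
  error carries two factors \<open>endval n\<close>, one from the observation and one from the forcing, and their square
  is at most \<open>exp n\<close>.\<close>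

lemma free_signal_bound:
  fixes b :: bool
  defines "\<beta> \<equiv> \<lambda>n. if even n = b then endval n else 0"
  assumes t: "0 < t" "t < 1"
  shows "cmod (\<Sum>m\<le>2 * N + 1. of_real (\<beta> (m div 2) / (2 * freq m + 1)) * amp m 0 * of_real (exp (freq m * t)))
    \<le> Y t + exp (9 * E) * I1"
proof -
  let ?k = "\<lambda>m. complex_of_real (\<beta> (m div 2) / (2 * freq m + 1))"
  have E1: "1 \<le> E" by simp
  have trm: "cmod (?k m * (amp m t - of_real (exp (freq m * t)) * amp m 0)) \<le> exp (5 * E) * (2 * \<mu> * I1)" if m: "m \<le> 2 * N + 1" for m
  proof -
    have k: "cmod (?k m) \<le> \<bar>endval (m div 2)\<bar>"
    proof -
      have "cmod (?k m) = \<bar>\<beta> (m div 2)\<bar> / \<bar>2 * freq m + 1\<bar>"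
        by (simp only: norm_of_real abs_divide)
      also have "\<dots> \<le> \<bar>\<beta> (m div 2)\<bar> / 1"
        by (intro divide_left_mono abs_freq_shift) (use abs_freq_shift(1)[of m] in auto)
      also have "\<dots> \<le> \<bar>endval (m div 2)\<bar>" by (simp add: \<beta>_def)
      finally show ?thesis .
    qed
    have "cmod (?k m * (amp m t - of_real (exp (freq m * t)) * amp m 0)) \<le>
       \<bar>endval (m div 2)\<bar> * (exp (2 * real m) * (2 * \<mu> * \<bar>endval (m div 2)\<bar> * I1))"
      unfolding norm_mult by (intro mult_mono k amp_estimate m t) auto
    also have "\<dots> = ((endval (m div 2))\<^sup>2 * exp (2 * real m)) * (2 * \<mu> * I1)"
      unfolding power2_abs[of "endval (m div 2)", symmetric] power2_eq_square by (simp only: mult_ac)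
    also have "\<dots> \<le> (exp (real (m div 2)) * exp (2 * real m)) * (2 * \<mu> * I1)"
      using mu I1_nonneg by (intro mult_right_mono endval_upper) auto
    also have "\<dots> \<le> exp (5 * E) * (2 * \<mu> * I1)"
    proof (intro mult_right_mono)
      have "m div 2 \<le> N" using m by simp
      then have "real (m div 2) + 2 * real m \<le> 5 * E" using m by (simp add: algebra_simps)
      then show "exp (real (m div 2)) * exp (2 * real m) \<le> exp (5 * E)" by (simp flip: exp_add)
    qed (use mu I1_nonneg in auto)
    finally show ?thesis .
  qed
  have "cmod (\<Sum>m\<le>2 * N + 1. ?k m * amp m 0 * of_real (exp (freq m * t)))
     = cmod ((\<Sum>m\<le>2 * N + 1. ?k m * amp m t) - (\<Sum>m\<le>2 * N + 1. ?k m * (amp m t - of_real (exp (freq m * t)) * amp m 0)))"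
    unfolding sum_subtractf[symmetric]
    by (intro arg_cong[where f = cmod] sum.cong refl)
       (simp only: right_diff_distrib diff_diff_eq2 add_diff_cancel_left' mult_ac)
  also have "\<dots> \<le> cmod (\<Sum>m\<le>2 * N + 1. ?k m * amp m t) + (\<Sum>m\<le>2 * N + 1. cmod (?k m * (amp m t - of_real (exp (freq m * t)) * amp m 0)))"
    by (intro order_trans[OF norm_triangle_ineq4] add_left_mono norm_sum)
  also have "\<dots> \<le> Y t + (\<Sum>m\<le>2 * N + 1. exp (5 * E) * (2 * \<mu> * I1))"
    unfolding amp_recombine unfolding \<beta>_def using t
    by (intro add_mono obs sum_mono trm[unfolded \<beta>_def]) auto
  also have "(\<Sum>m\<le>2 * N + 1. exp (5 * E) * (2 * \<mu> * I1)) = (2 * E) * (exp (5 * E) * (2 * \<mu> * I1))"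
    by (simp add: algebra_simps)
  also have "\<dots> = ((2 * E) * (2 * \<mu>)) * exp (5 * E) * I1" by simp
  also have "\<dots> \<le> (exp (2 * E) * exp (2 * E)) * exp (5 * E) * I1"
    using mu le_exp_self(1)[of "2 * E"] I1_nonneg
    by (intro mult_right_mono mult_mono) auto
  also have "\<dots> = exp (9 * E) * I1" by (simp flip: exp_add)
  finally show ?thesis by simp
qed

text \<open>Choose the parity of the mode to which \<open>m\<close> belongs, so that the coefficient of \<open>exp (freq m * t)\<close>
  in the free signal is not zero, and bound it by the integral of the signal.
  The exponent \<open>24\<close> is \<open>7 * 2\<close> for recovering a coefficient among \<open>2 E\<close> frequencies, plus \<open>10\<close> for the signal.\<close>

lemma initial_amplitude_bound:
  assumes m: "m \<le> 2 * N + 1"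
  shows "cmod (amp m 0) \<le> exp (29 * E) * I1"
proof -
  define b where "b = even (m div 2)"
  define \<beta> where "\<beta> n = (if even n = b then endval n else 0)" for n
  define c where "c m = of_real (\<beta> (m div 2) / (2 * freq m + 1)) * amp m 0" for m
  have iu: "(\<lambda>t. cmod (\<Sum>m\<le>2 * N + 1. c m * of_real (exp (freq m * t)))) integrable_on {0..1}"
    by (intro integrable_continuous_interval continuous_intros)
  have iY: "Y integrable_on {0..1}" by (intro integrable_continuous_interval cY)
  have iK: "(\<lambda>t :: real. exp (9 * E) * I1) integrable_on {0..1}" by (intro integrable_continuous_interval continuous_intros)
  have "integral {0..1} (\<lambda>t. cmod (\<Sum>m\<le>2 * N + 1. c m * of_real (exp (freq m * t)))) =
    integral {0<..<1} (\<lambda>t. cmod (\<Sum>m\<le>2 * N + 1. c m * of_real (exp (freq m * t))))"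
    by (rule integral_open_interval_real)
  also have "\<dots> \<le> integral {0<..<1} (\<lambda>t. Y t + exp (9 * E) * I1)"
  proof (rule integral_le)
    show "(\<lambda>t. cmod (\<Sum>m\<le>2 * N + 1. c m * of_real (exp (freq m * t)))) integrable_on {0<..<1}"
      "(\<lambda>t. Y t + exp (9 * E) * I1) integrable_on {0<..<1}"
      using iu integrable_add[OF iY iK] by (simp_all add: integrable_on_open_interval_real)
    fix t :: real assume "t \<in> {0<..<1}"
    then show "cmod (\<Sum>m\<le>2 * N + 1. c m * of_real (exp (freq m * t))) \<le> Y t + exp (9 * E) * I1"
      using free_signal_bound[of t b] by (simp add: c_def \<beta>_def)
  qed
  also have "\<dots> = integral {0..1} (\<lambda>t. Y t + exp (9 * E) * I1)" by (rule integral_open_interval_real[symmetric])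
  also have "\<dots> = I1 + exp (9 * E) * I1" by (subst integral_add[OF iY iK]) simp
  also have "\<dots> \<le> exp (10 * E) * I1"
  proof -
    have "1 + exp (9 * E) \<le> 2 * exp (9 * E)" by simp
    also have "\<dots> \<le> exp E * exp (9 * E)" by (intro mult_right_mono le_exp_self) auto
    also have "\<dots> = exp (10 * E)" by (simp flip: exp_add)
    finally have "(1 + exp (9 * E)) * I1 \<le> exp (10 * E) * I1" using I1_nonneg by (rule mult_right_mono)
    then show ?thesis by (simp add: distrib_right)
  qed
  finally have "exp (7 * (real (2 * N + 1) + 1)) * integral {0..1} (\<lambda>t. cmod (\<Sum>m\<le>2 * N + 1. c m * of_real (exp (freq m * t))))
     \<le> exp (7 * (real (2 * N + 1) + 1)) * (exp (10 * E) * I1)"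
    by (intro mult_left_mono) auto
  then have "cmod (c m) \<le> exp (7 * (real (2 * N + 1) + 1)) * (exp (10 * E) * I1)"
    using freq_coefficient_bound[OF m, of c] by linarith
  also have "\<dots> = exp (24 * E) * I1"
  proof -
    have "7 * (real (2 * N + 1) + 1) + 10 * E = 24 * E" by simp
    then show ?thesis by (simp only: mult.assoc[symmetric] exp_add[symmetric])
  qed
  finally have cm: "cmod (c m) \<le> exp (24 * E) * I1" .
  have b2: "1 / 2 \<le> \<bar>endval (m div 2)\<bar>"
    using endval_lower[of "m div 2"] real_sqrt_le_mono[of "1/4" "(endval (m div 2))\<^sup>2"]
    by (simp add: real_sqrt_divide)
  \<comment> \<open>Undo the factor between \<open>c m\<close> and the amplitude, using that \<open>endval\<close> is bounded below by \<open>1/2\<close>.\<close>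
  have "cmod (amp m 0) / 2 \<le> \<bar>endval (m div 2)\<bar> * cmod (amp m 0)"
    using b2 mult_right_mono[OF b2, of "cmod (amp m 0)"] by simp
  also have "\<dots> = \<bar>2 * freq m + 1\<bar> * cmod (c m)"
  proof -
    have "2 * freq m + 1 \<noteq> 0" using abs_freq_shift(1)[of m] by auto
    moreover have "cmod (c m) = \<bar>endval (m div 2)\<bar> / \<bar>2 * freq m + 1\<bar> * cmod (amp m 0)"
      unfolding c_def norm_mult norm_of_real by (simp add: \<beta>_def b_def abs_divide)
    ultimately show ?thesis by simp
  qed
  also have "\<dots> \<le> (2 * real m + 1) * (exp (24 * E) * I1)"
    by (intro mult_mono abs_freq_shift cm) auto
  also have "\<dots> \<le> exp (4 * E) * (exp (24 * E) * I1)"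
  proof (intro mult_right_mono)
    have "2 * real m + 1 \<le> 4 * E" using m by simp
    also have "\<dots> \<le> exp (4 * E)" by (rule le_exp_self) simp
    finally show "2 * real m + 1 \<le> exp (4 * E)" .
  qed (use I1_nonneg in auto)
  also have "\<dots> = exp (28 * E) * I1" by (simp add: mult.assoc[symmetric] flip: exp_add)
  finally have "cmod (amp m 0) \<le> 2 * (exp (28 * E) * I1)" by simp
  also have "\<dots> \<le> exp E * (exp (28 * E) * I1)"
    using I1_nonneg by (intro mult_right_mono le_exp_self) auto
  also have "\<dots> = exp (29 * E) * I1" by (simp add: mult.assoc[symmetric] flip: exp_add)
  finally show ?thesis .
qed

text \<open>Both \<open>p n 0\<close> and \<open>(2n + 1) a n 0\<close> are at most twice the bound \<open>exp (29 E) * I1\<close> on the amplitudes.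
  Squaring gives the exponent \<open>58\<close>, and the sum over the modes, with its numerical factor, costs \<open>4\<close> more.\<close>

lemma energy_bound:
  "(\<Sum>n\<le>N. (cmod (p n 0))\<^sup>2) + (\<Sum>n\<le>N. (cmod (of_real (2 * real n + 1) * a n 0))\<^sup>2) \<le> exp (62 * E) * integral {0..1} (\<lambda>t. (Y t)\<^sup>2)"
proof -
  define Z where "Z = exp (29 * E) * I1"
  have Z0: "0 \<le> Z" using I1_nonneg by (simp add: Z_def)
  have "(cmod (p n 0))\<^sup>2 + (cmod (of_real (2 * real n + 1) * a n 0))\<^sup>2 \<le> 8 * Z\<^sup>2" if n: "n \<le> N" for n
  proof -
    have d: "2 * n div 2 = n" "(2 * n + 1) div 2 = n" by auto
    have z1: "cmod (amp (2 * n) 0) \<le> Z" and z2: "cmod (amp (2 * n + 1) 0) \<le> Z"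
      unfolding Z_def using n by (intro initial_amplitude_bound; simp)+
    have "of_real (4 * real n + 1) * a n 0 = amp (2 * n) 0 - amp (2 * n + 1) 0"
      unfolding amp_def d freq_even freq_odd by (simp add: scaleR_conv_of_real algebra_simps)
    then have "(4 * real n + 1) * cmod (a n 0) = cmod (amp (2 * n) 0 - amp (2 * n + 1) 0)"
      by (metis abs_of_nonneg add_nonneg_nonneg mult_nonneg_nonneg norm_mult norm_of_real of_nat_0_le_iff zero_le_numeral zero_le_one)
    also have "\<dots> \<le> 2 * Z" using z1 z2 norm_triangle_ineq4[of "amp (2 * n) 0" "amp (2 * n + 1) 0"] by linarith
    finally have a4: "(4 * real n + 1) * cmod (a n 0) \<le> 2 * Z" .
    have nn: "0 \<le> real n * cmod (a n 0)" "0 \<le> cmod (a n 0)" by auto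
    have a2: "(2 * real n + 1) * cmod (a n 0) \<le> 2 * Z"
      using a4 nn unfolding distrib_right mult_1_left mult.assoc by linarith
    have "p n 0 = amp (2 * n + 1) 0 + of_real (2 * real n) * a n 0"
      unfolding amp_def d freq_odd by (simp add: scaleR_conv_of_real algebra_simps)
    then have "cmod (p n 0) \<le> cmod (amp (2 * n + 1) 0) + 2 * real n * cmod (a n 0)"
      using norm_triangle_ineq[of "amp (2 * n + 1) 0" "of_real (2 * real n) * a n 0"] by (simp add: norm_mult)
    then have p2: "cmod (p n 0) \<le> 2 * Z" using z2 a4 nn unfolding distrib_right mult_1_left mult.assoc by linarith
    have "cmod (of_real (2 * real n + 1) * a n 0) = (2 * real n + 1) * cmod (a n 0)"
      by (simp only: norm_mult norm_of_real)
    then have "(cmod (of_real (2 * real n + 1) * a n 0))\<^sup>2 \<le> (2 * Z)\<^sup>2"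
      using a2 by (intro power_mono) auto
    moreover have "(cmod (p n 0))\<^sup>2 \<le> (2 * Z)\<^sup>2"
      using p2 by (intro power_mono) auto
    ultimately show ?thesis by (simp add: power_mult_distrib)
  qed
  then have "(\<Sum>n\<le>N. (cmod (p n 0))\<^sup>2 + (cmod (of_real (2 * real n + 1) * a n 0))\<^sup>2) \<le> (\<Sum>n\<le>N. 8 * Z\<^sup>2)"
    by (intro sum_mono) auto
  also have "\<dots> = (8 * E) * Z\<^sup>2" by (simp add: algebra_simps)
  also have "\<dots> \<le> exp (4 * E) * Z\<^sup>2"
  proof (intro mult_right_mono)
    have e: "2 \<le> exp E" "E \<le> exp E" by (auto intro: le_exp_self)
    have "2 * 2 * 2 * E \<le> exp E * exp E * exp E * exp E"
      by (intro mult_mono e) auto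
    also have "\<dots> = exp (4 * E)" by (simp flip: exp_add)
    finally show "8 * E \<le> exp (4 * E)" by simp
  qed simp
  also have "Z\<^sup>2 = exp (58 * E) * I1\<^sup>2"
    unfolding Z_def power_mult_distrib by (simp add: power2_eq_square flip: exp_add)
  also have "exp (4 * E) * (exp (58 * E) * I1\<^sup>2) = exp (62 * E) * I1\<^sup>2"
    by (simp add: mult.assoc[symmetric] flip: exp_add)
  also have "\<dots> \<le> exp (62 * E) * integral {0..1} (\<lambda>t. (Y t)\<^sup>2)"
    by (intro mult_left_mono integral_square_le cY) auto
  finally show ?thesis by (simp add: sum.distrib)
qed

end

section \<open>The observability estimate\<close>

lemma HN_coeff_lincomb:
  assumes "f \<in> HN N" "g \<in> HN N"
  shows "(\<lambda>x. f x + c * g x) \<in> HN N"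
    and "innerH (\<lambda>x. f x + c * g x) (Phi n) = innerH f (Phi n) + c * innerH g (Phi n)"
proof -
  obtain u v where uv: "f = phi_sum N u" "g = phi_sum N v" using assms by (auto simp: HN_iff)
  have e: "(\<lambda>x. f x + c * g x) = phi_sum N (\<lambda>n. u n + c * v n)"
    unfolding uv phi_sum_def sum_distrib_left sum.distrib[symmetric]
    by (intro ext sum.cong refl) (simp add: algebra_simps)
  show "(\<lambda>x. f x + c * g x) \<in> HN N" unfolding e by simp
  show "innerH (\<lambda>x. f x + c * g x) (Phi n) = innerH f (Phi n) + c * innerH g (Phi n)"
    unfolding e unfolding uv innerH_phi_sum_Phi by simp
qed

lemma cont_curve_coeff:
  assumes c: "cont_curve N u" and n: "n \<le> N"
  shows "continuous_on {0..1} (\<lambda>t. innerH (u t) (Phi n))"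
  unfolding continuous_on_def
proof
  fix t :: real assume t: "t \<in> {0..1}"
  have u: "u s \<in> HN N" if "s \<in> {0..1}" for s using c that by (auto simp: cont_curve_def)
  have "((\<lambda>s. innerH (u s) (Phi n) - innerH (u t) (Phi n)) \<longlongrightarrow> 0) (at t within {0..1})"
  proof (rule Lim_null_comparison)
    show "((\<lambda>s. normH (\<lambda>x. u s x - u t x)) \<longlongrightarrow> 0) (at t within {0..1})"
      using c t by (auto simp: cont_curve_def)
    show "\<forall>\<^sub>F s in at t within {0..1}. norm (innerH (u s) (Phi n) - innerH (u t) (Phi n)) \<le> normH (\<lambda>x. u s x - u t x)"
      unfolding eventually_at_filter
    proof (intro always_eventually allI impI)
      fix s :: real assume s: "s \<in> {0..1}"
      have "(\<lambda>x. u s x - u t x) \<in> HN N"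
        using HN_coeff_lincomb(1)[OF u[OF s] u[OF t], of "-1"] by simp
      moreover have "innerH (\<lambda>x. u s x - u t x) (Phi n) = innerH (u s) (Phi n) - innerH (u t) (Phi n)"
        using HN_coeff_lincomb(2)[OF u[OF s] u[OF t], of "-1"] by simp
      ultimately show "norm (innerH (u s) (Phi n) - innerH (u t) (Phi n)) \<le> normH (\<lambda>x. u s x - u t x)"
        using cmod_coeff_le_normH[OF _ n] by metis
    qed
  qed
  then show "((\<lambda>t. innerH (u t) (Phi n)) \<longlongrightarrow> innerH (u t) (Phi n)) (at t within {0..1})"
    by (simp add: LIM_zero_iff)
qed

text \<open>On an interval of finite length an integrable square dominates: \<open>normH (u t) \<le> 1 + (normH (u t))\<^sup>2\<close>.\<close>

lemma L2_curve_coeff: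
  assumes u: "L2_curve N u" and n: "n \<le> N"
  shows "integrable (lebesgue_on {0<..<1}) (\<lambda>t. innerH (u t) (Phi n))"
proof (rule Bochner_Integration.integrable_bound)
  show "integrable (lebesgue_on {0<..<1}) (\<lambda>t. 1 + (normH (u t))\<^sup>2)"
    using u integrable_lebesgue_on_open_interval[of 0 1 "\<lambda>_. 1 :: real"]
    by (intro Bochner_Integration.integrable_add) (auto simp: L2_curve_def)
  show "(\<lambda>t. innerH (u t) (Phi n)) \<in> borel_measurable (lebesgue_on {0<..<1})"
    using u Phi_in_HN[OF n] by (auto simp: L2_curve_def)
  have "AE t in lebesgue_on {0<..<1}. u t \<in> HN N" using u by (auto simp: L2_curve_def)
  then show "AE t in lebesgue_on {0<..<1}. norm (innerH (u t) (Phi n)) \<le> norm (1 + (normH (u t))\<^sup>2)"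
  proof eventually_elim
    case (elim t)
    have "0 \<le> (normH (u t) - 1)\<^sup>2" by simp
    then have "2 * normH (u t) \<le> 1 + (normH (u t))\<^sup>2" by (simp add: power2_diff)
    moreover have "cmod (innerH (u t) (Phi n)) \<le> normH (u t)" by (rule cmod_coeff_le_normH[OF elim n])
    ultimately have "cmod (innerH (u t) (Phi n)) \<le> 1 + (normH (u t))\<^sup>2"
      using norm_ge_zero[of "innerH (u t) (Phi n)"] by linarith
    also have "\<dots> \<le> norm (1 + (normH (u t))\<^sup>2)" unfolding real_norm_def by (rule abs_ge_self)
    finally show ?case .
  qed
qed

lemma norm_C2: "norm (v :: complex ^ 2) = sqrt ((cmod (v $ 1))\<^sup>2 + (cmod (v $ 2))\<^sup>2)"
  by (simp add: norm_vec_def L2_set_def sum_2)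

lemma endpoint_values:
  assumes "f \<in> HN N"
  shows "f 0 = (\<Sum>n\<le>N. of_real (endval n) * innerH f (Phi n))"
    "f pi = (\<Sum>n\<le>N. of_real ((-1) ^ n * endval n) * innerH f (Phi n))"
proof -
  have e: "f x = (\<Sum>n\<le>N. Phi n x * innerH f (Phi n))" for x
    using fun_cong[OF HN_expand[OF assms], of x] by (simp add: phi_sum_def mult.commute)
  show "f 0 = (\<Sum>n\<le>N. of_real (endval n) * innerH f (Phi n))"
    "f pi = (\<Sum>n\<le>N. of_real ((-1) ^ n * endval n) * innerH f (Phi n))"
    using e[of 0] e[of pi] by (simp_all only: Phi_endpoints)
qed

text \<open>Half the sum and half the difference of the endpoint values select the even and the odd modes.\<close>

lemma parity_observation:
  assumes "f \<in> HN N"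
  shows "cmod (\<Sum>n\<le>N. of_real (if even n = b then endval n else 0) * innerH f (Phi n)) \<le> norm (C_obs f)"
proof -
  define s :: complex where "s = (if b then 1 else -1)"
  have "(\<Sum>n\<le>N. of_real (if even n = b then endval n else 0) * innerH f (Phi n)) = (f 0 + s * f pi) / 2"
    unfolding endpoint_values[OF assms] sum_distrib_left sum.distrib[symmetric] sum_divide_distrib
    by (intro sum.cong refl) (auto simp: s_def)
  also have "cmod \<dots> \<le> (cmod (f 0) + cmod (f pi)) / 2"
    using norm_triangle_ineq[of "f 0" "s * f pi"] by (simp add: norm_divide norm_mult s_def split: if_splits)
  also have "\<dots> \<le> norm (C_obs f)"
    using Finite_Cartesian_Product.norm_nth_le[of "C_obs f" 1] Finite_Cartesian_Product.norm_nth_le[of "C_obs f" 2] by (simp add: C_obs_def)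
  finally show ?thesis .
qed

theorem theorem10p2:
  "\<exists>C0 C :: real. C0 \<ge> 1 \<and> C > 0 \<and>
     (\<forall>(N :: nat) (\<mu> :: real) (\<Gamma> :: real \<Rightarrow> complex ^ 2 ^ 2)
        (q :: real \<Rightarrow> real \<Rightarrow> complex) (qt :: real \<Rightarrow> real \<Rightarrow> complex) (qtt :: real \<Rightarrow> real \<Rightarrow> complex).
        \<mu> \<ge> 0 \<longrightarrow>
        \<Gamma> \<in> borel_measurable (lebesgue_on {0<..<1}) \<longrightarrow>
        (AE t in lebesgue_on {0<..<1}. onorm ((*v) (\<Gamma> t)) \<le> \<mu>) \<longrightarrow>
        H2_curve N q qt qtt \<longrightarrow>
        (AE t in lebesgue_on {0<..<1}. \<forall>x\<in>{0..pi}.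
           qtt t x + qt t x - A0 (q t) x = C_adj N (\<Gamma> t *v C_obs (q t)) x) \<longrightarrow>
        real N + 1 \<ge> C0 * (1 + \<mu>\<^sup>2) \<longrightarrow>
        energy0 q qt
          \<le> exp (C * (real N + 1)) * (LINT t|lebesgue_on {0<..<1}. (norm (C_obs (q t)))\<^sup>2))"
proof (rule exI[of _ 1], rule exI[of _ 62], intro conjI allI impI)
  fix N :: nat and \<mu> :: real and \<Gamma> :: "real \<Rightarrow> complex ^ 2 ^ 2" and q qt qtt :: "real \<Rightarrow> real \<Rightarrow> complex"
  assume mu0: "\<mu> \<ge> 0" and on: "AE t in lebesgue_on {0<..<1}. onorm ((*v) (\<Gamma> t)) \<le> \<mu>"
    and H2: "H2_curve N q qt qtt"
    and pde: "AE t in lebesgue_on {0<..<1}. \<forall>x\<in>{0..pi}.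
           qtt t x + qt t x - A0 (q t) x = C_adj N (\<Gamma> t *v C_obs (q t)) x"
    and muN: "real N + 1 \<ge> 1 * (1 + \<mu>\<^sup>2)"
  define a p r where "a n t = innerH (q t) (Phi n)" and "p n t = innerH (qt t) (Phi n)"
    and "r n t = innerH (qtt t) (Phi n)" for n t
  define Y where "Y t = norm (C_obs (q t))" for t
  have curve: "L2_curve N qtt" "weak_deriv N q qt" "weak_deriv N qt qtt" "cont_curve N q" "cont_curve N qt"
    using H2 by (auto simp: H2_curve_def)
  have q: "q t \<in> HN N" "qt t \<in> HN N" if "t \<in> {0..1}" for t
    using curve(4,5) that by (auto simp: cont_curve_def)
  have ca: "continuous_on {0..1} (a n)" if "n \<le> N" for n
    unfolding a_def[abs_def] by (rule cont_curve_coeff[OF curve(4) that])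
  have cY: "continuous_on {0..1} Y"
  proof -
    have "continuous_on {0..1} (\<lambda>t. sqrt ((cmod (\<Sum>n\<le>N. of_real (endval n) * a n t))\<^sup>2 +
        (cmod (\<Sum>n\<le>N. of_real ((-1) ^ n * endval n) * a n t))\<^sup>2))"
      by (intro continuous_intros ca) auto
    then show ?thesis
      by (rule continuous_on_eq)
         (simp add: Y_def norm_C2 C_obs_def a_def endpoint_values[OF q(1)])
  qed
  interpret modal_system N \<mu> a p r Y
  proof
    show "0 \<le> \<mu>" by (rule mu0)
    have "0 \<le> (\<mu> - 1)\<^sup>2" by simp
    then have "2 * \<mu> \<le> 1 + \<mu>\<^sup>2" by (simp add: power2_diff)
    moreover have "1 + \<mu>\<^sup>2 \<le> real N + 1" using muN by simp
    ultimately have "2 * \<mu> \<le> real N + 1" by (rule order_trans)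
    with mu0 show "\<mu> \<le> real N + 1" by simp
    show "continuous_on {0..1} Y" by (rule cY)
    show "cmod (\<Sum>n\<le>N. of_real (if even n = b then endval n else 0) * a n t) \<le> Y t" if "t \<in> {0..1}" for b t
      unfolding a_def Y_def by (rule parity_observation[OF q(1)[OF that]])
    fix n assume n: "n \<le> N"
    show "continuous_on {0..1} (a n)" by (rule ca[OF n])
    show "continuous_on {0..1} (p n)"
      unfolding p_def[abs_def] by (rule cont_curve_coeff[OF curve(5) n])
    show "integrable (lebesgue_on {0<..<1}) (r n)"
      unfolding r_def[abs_def] by (rule L2_curve_coeff[OF curve(1) n])
    show "has_weak_derivative (a n) (p n)" "has_weak_derivative (p n) (r n)"
      unfolding a_def[abs_def] p_def[abs_def] r_def[abs_def]
      by (intro weak_deriv_coeff[OF _ n] curve)+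
    have sp: "AE t in lebesgue_on {0<..<1}. t \<in> {0<..<1 :: real}"
      by (rule AE_I2) (auto simp: space_restrict_space)
    have "AE t in lebesgue_on {0<..<1}. qtt t \<in> HN N"
      using curve(1) by (auto simp: L2_curve_def)
    from this on pde sp
    show "AE t in lebesgue_on {0<..<1}.
        cmod (r n t + p n t - of_real (2 * real n * (2 * real n + 1)) * a n t) \<le> 2 * \<mu> * \<bar>endval n\<bar> * Y t"
    proof eventually_elim
      case (elim t)
      define w where "w = \<Gamma> t *v C_obs (q t)"
      have t: "t \<in> {0..1}" using elim(4) by auto
      have "r n t + p n t - of_real (2 * real n * (2 * real n + 1)) * a n t = Phi n 0 * w $ 1 + Phi n pi * w $ 2"
      proof (rule phi_sum_eqD[OF _ n, where c = "\<lambda>n. r n t + p n t - of_real (2 * real n * (2 * real n + 1)) * a n t"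
            and d = "\<lambda>n. Phi n 0 * w $ 1 + Phi n pi * w $ 2"])
        fix x assume "x \<in> {0..pi}"
        then have "qtt t x + qt t x - A0 (q t) x = phi_sum N (\<lambda>n. Phi n 0 * w $ 1 + Phi n pi * w $ 2) x"
          using elim(3) by (simp add: C_adj_eq w_def)
        moreover have "qtt t x = phi_sum N (\<lambda>n. r n t) x" "qt t x = phi_sum N (\<lambda>n. p n t) x"
          using HN_expand[OF elim(1)] HN_expand[OF q(2)[OF t]] by (simp_all only: r_def p_def)
        moreover have "A0 (q t) x = phi_sum N (\<lambda>n. of_real (2 * real n * (2 * real n + 1)) * a n t) x"
          unfolding A0_def a_def by (subst diag_op_HN[OF q(1)[OF t]]) (rule refl)
        ultimately show "phi_sum N (\<lambda>n. r n t + p n t - of_real (2 * real n * (2 * real n + 1)) * a n t) x =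
            phi_sum N (\<lambda>n. Phi n 0 * w $ 1 + Phi n pi * w $ 2) x"
          by (simp add: phi_sum_def sum.distrib sum_subtractf left_diff_distrib distrib_right)
      qed
      also have "cmod \<dots> \<le> \<bar>endval n\<bar> * cmod (w $ 1) + \<bar>endval n\<bar> * cmod (w $ 2)"
        unfolding Phi_endpoints
        by (intro order_trans[OF norm_triangle_ineq]) (simp add: norm_mult norm_power)
      also have "\<dots> \<le> \<bar>endval n\<bar> * (\<mu> * Y t) + \<bar>endval n\<bar> * (\<mu> * Y t)"
      proof -
        have "norm w \<le> onorm ((*v) (\<Gamma> t)) * norm (C_obs (q t))"
          unfolding w_def by (rule onorm[OF matrix_vector_mul_bounded_linear])
        also have "\<dots> \<le> \<mu> * Y t" unfolding Y_def by (intro mult_right_mono elim(2)) auto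
        finally have "norm w \<le> \<mu> * Y t" .
        then have "cmod (w $ i) \<le> \<mu> * Y t" for i using Finite_Cartesian_Product.norm_nth_le[of w i] by linarith
        then show ?thesis by (intro add_mono mult_left_mono) auto
      qed
      finally show ?case by (simp add: algebra_simps)
    qed
  qed
  have z0: "(0 :: real) \<in> {0..1}" by simp
  have "(normH (qt 0))\<^sup>2 = (\<Sum>n\<le>N. (cmod (p n 0))\<^sup>2)"
    by (subst HN_expand[OF q(2)[OF z0]]) (simp only: normH_sq_phi_sum p_def)
  moreover have "(\<lambda>x. T_op (q 0) x + q 0 x) = phi_sum N (\<lambda>n. of_real (2 * real n + 1) * a n 0)"
  proof
    fix x
    have "q 0 x = phi_sum N (\<lambda>n. a n 0) x"
      using HN_expand[OF q(1)[OF z0]] by (simp only: a_def)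
    moreover have "T_op (q 0) x = phi_sum N (\<lambda>n. of_real (2 * real n) * a n 0) x"
      unfolding T_op_def a_def by (subst diag_op_HN[OF q(1)[OF z0]]) (rule refl)
    ultimately show "T_op (q 0) x + q 0 x = phi_sum N (\<lambda>n. of_real (2 * real n + 1) * a n 0) x"
      by (simp add: phi_sum_def sum.distrib distrib_right)
  qed
  then have "(normH (\<lambda>x. T_op (q 0) x + q 0 x))\<^sup>2 = (\<Sum>n\<le>N. (cmod (of_real (2 * real n + 1) * a n 0))\<^sup>2)"
    by (simp only: normH_sq_phi_sum)
  ultimately have "energy0 q qt \<le> exp (62 * (real N + 1)) * integral {0..1} (\<lambda>t. (Y t)\<^sup>2)"
    unfolding energy0_def using energy_bound by simp
  also have "integral {0..1} (\<lambda>t. (Y t)\<^sup>2) = (LINT t|lebesgue_on {0<..<1}. (norm (C_obs (q t)))\<^sup>2)"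
    unfolding Y_def[symmetric] by (rule lebesgue_integral_unit_interval[symmetric]) (intro continuous_intros cY)
  finally show "energy0 q qt \<le> exp (62 * (real N + 1)) * (LINT t|lebesgue_on {0<..<1}. (norm (C_obs (q t)))\<^sup>2)" .
qed auto

end
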